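(* Let $\lambda,\mu$ be dominant integral weights of $\mathfrak{gl}_{m|n}$. Then $K_{\lambda,\mu}(q)\neq 0$ if and only if $\mu\preccurlyeq\lambda$, and in this case $$K_{\lambda,\mu}(q)=q^{\ell(\lambda,\mu)}\sum_{\sigma\in S^{\lambda,\mu}}q^{-2\ell(\sigma)}=q^{\ell(\lambda,\mu)}\,S^{\lambda,\mu}(q^{-2}),$$ where $S^{\lambda,\mu}(q)=\sum_{\sigma\in S^{\lambda,\mu}}q^{\ell(\sigma)}$. Moreover $S^{\lambda,\mu}(q)$ is given by $S^{\lambda,\mu}(q)=Z_q(h(\lambda);b^{\lambda,\mu})$.
   Context: **Weights.** Fix positive integers $m,n$ and $\mathfrak{gl}_{m|n}$. For $\zeta\in\{1,\dots,n\}$ write $\dot\zeta=m+\zeta$. An integral weight is a tuple $\lambda=(\lambda_1,\dots,\lambda_m\,|\,\lambda_{\dot1},\dots,\lambda_{\dot n})\in\mathbb Z^{m|n}$, standing for $\sum_i\lambda_i\epsilon_i-\sum_\zeta\lambda_{\dot\zeta}\delta_\zeta$. It is dominant if $\lambda_1\ge\dots\ge\lambda_m$ and $\lambda_{\dot1}\le\dots\le\lambda_{\dot n}$; $P_+$ is the set of dominant integral weights. Put $\rho=(m,\dots,2,1\,|\,1,2,\dots,n)$ and $\lambda^\rho=\lambda+\rho$. $W=\mathrm{Sym}_m\times\mathrm{Sym}_n$ acts by $w\cdot\lambda=w(\lambda+\rho)-\rho$. $\lambda$ is regular if the first $m$ entries of $\lambda^\rho$ are distinct and the last $n$ entries of $\lambda^\rho$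 are distinct; then $\lambda^+$ is the unique dominant weight in its dot-orbit. For an entry tuple $a$, $\mathrm{Set}(a)$ is the set of its entries. **Atypicality.** The atypical roots of a regular $\lambda$ are the $\epsilon_i-\delta_\zeta$ with $\lambda^\rho_i=\lambda^\rho_{\dot\zeta}$; their number is $\#\lambda$; if $\#\lambda=r$, $\lambda$ is $r$-fold atypical. For dominant $\lambda$ they are $\gamma_s=\epsilon_{m_s}-\delta_{n_s}$, $s=1,\dots,r$, with $m_r<\dots<m_1$, $n_1<\dots<n_r$. The atypical tuple is $\mathrm{aty}_\lambda=(\lambda^\rho_{\dot n_1},\dots,\lambda^\rho_{\dot n_r})$ and the typical tuple $\mathrm{typ}_\lambda\in\mathbb Z^{m-r|n-r}$ is obtained from $\lambda^\rho$ by deleting the entries at positions $m_s,\dot n_s$. For $\mu$ dominant the atypical roots are written $\epsilon_{m'_s}-\delta_{n'_s}$, in the same ordering. $P_r$ is the set of $r$-fold atypical regular weights whose atypical roots can be indexed as $\epsilon_{m_s}-\delta_{n_s}$ with $m_r<\dots<m_1$, $n_1<\dots<n_r$, and whose typical tuple is dominant; $\mathrm{aty},\mathrm{typ}$ are defined for them by the same formulas. **Order.** $\mu\preccurlyeq\lambda$ iff $\#\mu=\#\lambda$, $\mathrm{typ}_\mu=\mathrm{typ}_\lambda$ and $\mathrm{aty}_\mu\le\mathrm{aty}_\lambda$ entrywise. **Heights.** For dominant $\lambda$: $h_s(\lambda)=\lambda_{m_s}-n_s+s$, $h(\lambda)=(h_1(\lambda),\dots,h_r(\lambda))$, $|h(\lambda)|=\sum_sh_s(\lambda)$,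 $\ell(\lambda,\mu)=|h(\lambda)|-|h(\mu)|$. For $s\le t$: $d_{s,t}(\lambda)=h_t(\lambda)-h_s(\lambda)$; $c_{s,t}(\lambda)=1$ if $s=t$ or $d_{s,t}(\lambda)<t-s$, and $0$ otherwise; $\hat c_{s,t}(\lambda)=1$ if $c_{s,s}(\lambda)=c_{s,s+1}(\lambda)=\dots=c_{s,t}(\lambda)=1$, and $0$ otherwise. **Permutations.** $S^\lambda=\{\sigma\in\mathrm{Sym}_r:\sigma^{-1}(s)<\sigma^{-1}(t)\text{ for all }s<t\text{ with }\hat c_{s,t}(\lambda)=1\}$ and $S^{\lambda,\mu}=\{\sigma\in S^\lambda:\mu^\rho_{\dot n'_s}\le\lambda^\rho_{\dot n_{\sigma(s)}}\text{ for all }s=1,\dots,r\}$ (for $\mathrm{typ}_\mu=\mathrm{typ}_\lambda$). $\ell(\sigma)=\#\{(s,t):s<t,\ \sigma(t)<\sigma(s)\}$. **Kazhdan–Lusztig polynomials.** For $\lambda\in P_r$ define positive integers $k_1,\dots,k_r$ as follows: start with $S=\mathrm{Set}(\lambda^\rho)$; process the indices $s$ in decreasing order of the values $\lambda^\rho_{\dot n_s}$; for each $s$ let $k$ be the smallest integer $>\lambda^\rho_{\dot n_s}$ not in the current $S$, put $k_s=k-\lambda^\rho_{\dot n_s}$, and add $k$ to $S$. The raising operator is $R_{m_s,\dot n_s}(\lambda)=\lambda+k_s\gamma_s\in P_r$ (adding $\gamma_s$ adds $1$ to the entries at positions $m_s$ and $\dot n_s$). For $\mu\in P_+$ with $\#\mu=r$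 and $\theta\in\mathbb N^r$ ($\mathbb N=\{0,1,\dots\}$), put $R'_\theta(\mu)=\big(R^{\theta_1}_{m'_1,\dot n'_1}\circ\cdots\circ R^{\theta_r}_{m'_r,\dot n'_r}(\mu)\big)^+$. $K_{\lambda,\mu}(q)$ is Serganova's generalized Kazhdan–Lusztig polynomial for $\mathfrak{gl}_{m|n}$, which by a theorem of Brundan equals (and may here be taken to be defined by) $$K_{\lambda,\mu}(q)=\sum_{\theta\in\mathbb N^{r}:\,R'_\theta(\mu)=\lambda}q^{|\theta|},\qquad|\theta|=\sum_s\theta_s,$$ for $\#\mu=\#\lambda=r$, and $K_{\lambda,\mu}(q)=0$ if $\#\lambda\ne\#\mu$. **The functions $Z_q$.** For $x,b\in\mathbb Z^r$, $Z_q(x;b)=0$ unless $x_1\le\dots\le x_r$, $b_1\le\dots\le b_r$ and $1\le b_s\le s$ for all $s$; in that case, with $\theta(y)=1$ if $y\ge0$ and $0$ otherwise: $Z_q(x_1;1)=1$, $Z_q(x_1,x_2;1,b_2)=1+\theta(x_2-x_1-1)\theta(1-b_2)q$, and inductively, with $b^{(r-1)}=(b_1,\dots,b_{r-1})$, $$Z_q(x;b)=Z_q(x_1,\dots,x_{r-1};b^{(r-1)})+\sum_{i=b_r}^{r-1}\theta(x_{i+1}-x_i-1)\,Z_q(x_1,\dots,x_{i-1},x_{i+1}-1,\dots,x_r-1;b^{(r-1)})\,q^{r-i}.$$ For $\mu\preccurlyeq\lambda$, $b^{\lambda,\mu}=(i_1,\dots,i_r)$ with $i_s=\min\{i\in\{1,\dots,r\}:\mu^\rho_{\dot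 n'_s}\le\lambda^\rho_{\dot n_i}\}$. *)

theory Defs
  imports
    "HOL-Computational_Algebra.Polynomial_FPS"
    "HOL-Computational_Algebra.Formal_Laurent_Series"
    "HOL-Combinatorics.Permutations"
    "HOL-Library.FuncSet"
begin

section \<open>Weights\<close>

text \<open>
  An integral weight of gl(m|n) is a function on positions \<open>1, \<dots>, m + n\<close>, extended by \<open>0\<close>; the
  dotted position of \<open>\<zeta> \<in> {1..n}\<close> is \<open>m + \<zeta>\<close>.  The coefficient of \<open>\<delta>\<^sub>\<zeta>\<close> is \<open>- lam (m + \<zeta>)\<close>.
\<close>

definition integral_weights :: "nat \<Rightarrow> nat \<Rightarrow> (nat \<Rightarrow> int) set" where
  "integral_weights m n = {lam. \<forall>i. i \<notin> {1..m+n} \<longrightarrow> lam i = 0}"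

definition dominant_weights :: "nat \<Rightarrow> nat \<Rightarrow> (nat \<Rightarrow> int) set" where
  "dominant_weights m n =
     {lam \<in> integral_weights m n. antimono_on {1..m} lam \<and> mono_on {m+1..m+n} lam}"

definition rho :: "nat \<Rightarrow> nat \<Rightarrow> nat \<Rightarrow> int" where
  "rho m n i = (if i \<in> {1..m} then int m + 1 - int i
                else if i \<in> {m+1..m+n} then int i - int m else 0)"

definition rho_shift :: "nat \<Rightarrow> nat \<Rightarrow> (nat \<Rightarrow> int) \<Rightarrow> nat \<Rightarrow> int" where
  "rho_shift m n lam = (\<lambda>i. lam i + rho m n i)"

text \<open>\<open>Sym m \<times> Sym n\<close>, embedded in the permutations of \<open>{1..m+n}\<close>.\<close>

definition weyl_group :: "nat \<Rightarrow> nat \<Rightarrow> (nat \<Rightarrow> nat) set" where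
  "weyl_group m n = {w. w permutes {1..m+n} \<and> w ` {1..m} = {1..m}}"

definition dot_action :: "nat \<Rightarrow> nat \<Rightarrow> (nat \<Rightarrow> nat) \<Rightarrow> (nat \<Rightarrow> int) \<Rightarrow> nat \<Rightarrow> int" where
  "dot_action m n w lam = (\<lambda>i. rho_shift m n lam (inv w i) - rho m n i)"

text \<open>Meaningful for regular weights only: otherwise the dot-orbit has no dominant element.\<close>

definition dominant_rep :: "nat \<Rightarrow> nat \<Rightarrow> (nat \<Rightarrow> int) \<Rightarrow> nat \<Rightarrow> int" where
  "dominant_rep m n lam =
     (THE \<nu>. \<nu> \<in> dominant_weights m n \<and> (\<exists>w \<in> weyl_group m n. \<nu> = dot_action m n w lam))"


section \<open>Atypicality\<close>

text \<open>The pair \<open>(i, \<zeta>)\<close> stands for the root \<open>\<epsilon>\<^sub>i - \<delta>\<^sub>\<zeta>\<close>.\<close>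

definition atyp_roots :: "nat \<Rightarrow> nat \<Rightarrow> (nat \<Rightarrow> int) \<Rightarrow> (nat \<times> nat) set" where
  "atyp_roots m n lam =
     {(i, \<zeta>). i \<in> {1..m} \<and> \<zeta> \<in> {1..n} \<and> rho_shift m n lam i = rho_shift m n lam (m + \<zeta>)}"

definition atypicality :: "nat \<Rightarrow> nat \<Rightarrow> (nat \<Rightarrow> int) \<Rightarrow> nat" where
  "atypicality m n lam = card (atyp_roots m n lam)"

text \<open>
  \<open>m\<^sub>s\<close> and \<open>n\<^sub>s\<close> for \<open>s \<in> {1..r}\<close>: the rows of the atypical roots in decreasing order and their
  columns in increasing order.  For dominant weights, and more generally for the regular weights
  whose atypical roots can be indexed with \<open>m\<^sub>r < \<dots> < m\<^sub>1\<close> and \<open>n\<^sub>1 < \<dots> < n\<^sub>r\<close>, the atypical roots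
  are exactly the pairs \<open>(m\<^sub>s, n\<^sub>s)\<close>.
\<close>

definition atyp_row :: "nat \<Rightarrow> nat \<Rightarrow> (nat \<Rightarrow> int) \<Rightarrow> nat \<Rightarrow> nat" where
  "atyp_row m n lam s = rev (sorted_list_of_set (fst ` atyp_roots m n lam)) ! (s - 1)"

definition atyp_col :: "nat \<Rightarrow> nat \<Rightarrow> (nat \<Rightarrow> int) \<Rightarrow> nat \<Rightarrow> nat" where
  "atyp_col m n lam s = sorted_list_of_set (snd ` atyp_roots m n lam) ! (s - 1)"

definition atypical_tuple :: "nat \<Rightarrow> nat \<Rightarrow> (nat \<Rightarrow> int) \<Rightarrow> nat \<Rightarrow> int" where
  "atypical_tuple m n lam s = rho_shift m n lam (m + atyp_col m n lam s)"

definition typical_tuple :: "nat \<Rightarrow> nat \<Rightarrow> (nat \<Rightarrow> int) \<Rightarrow> int list \<times> int list" where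
  "typical_tuple m n lam =
     (map (rho_shift m n lam) (filter (\<lambda>i. i \<notin> fst ` atyp_roots m n lam) [1..<m+1]),
      map (\<lambda>\<zeta>. rho_shift m n lam (m + \<zeta>)) (filter (\<lambda>\<zeta>. \<zeta> \<notin> snd ` atyp_roots m n lam) [1..<n+1]))"

definition weight_le :: "nat \<Rightarrow> nat \<Rightarrow> (nat \<Rightarrow> int) \<Rightarrow> (nat \<Rightarrow> int) \<Rightarrow> bool" where
  "weight_le m n \<mu> lam \<longleftrightarrow>
     atypicality m n \<mu> = atypicality m n lam \<and> typical_tuple m n \<mu> = typical_tuple m n lam \<and>
     (\<forall>s \<in> {1..atypicality m n lam}. atypical_tuple m n \<mu> s \<le> atypical_tuple m n lam s)"


section \<open>Heights and permutations\<close>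

definition height :: "nat \<Rightarrow> nat \<Rightarrow> (nat \<Rightarrow> int) \<Rightarrow> nat \<Rightarrow> int" where
  "height m n lam s = lam (atyp_row m n lam s) - int (atyp_col m n lam s) + int s"

definition total_height :: "nat \<Rightarrow> nat \<Rightarrow> (nat \<Rightarrow> int) \<Rightarrow> int" where
  "total_height m n lam = (\<Sum>s = 1..atypicality m n lam. height m n lam s)"

definition rel_length :: "nat \<Rightarrow> nat \<Rightarrow> (nat \<Rightarrow> int) \<Rightarrow> (nat \<Rightarrow> int) \<Rightarrow> int" where
  "rel_length m n lam \<mu> = total_height m n lam - total_height m n \<mu>"

definition height_dist :: "nat \<Rightarrow> nat \<Rightarrow> (nat \<Rightarrow> int) \<Rightarrow> nat \<Rightarrow> nat \<Rightarrow> int" where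
  "height_dist m n lam s t = height m n lam t - height m n lam s"

definition c_rel :: "nat \<Rightarrow> nat \<Rightarrow> (nat \<Rightarrow> int) \<Rightarrow> nat \<Rightarrow> nat \<Rightarrow> nat" where
  "c_rel m n lam s t = (if s = t \<or> height_dist m n lam s t < int t - int s then 1 else 0)"

definition c_hat :: "nat \<Rightarrow> nat \<Rightarrow> (nat \<Rightarrow> int) \<Rightarrow> nat \<Rightarrow> nat \<Rightarrow> nat" where
  "c_hat m n lam s t = (if \<forall>u \<in> {s..t}. c_rel m n lam s u = 1 then 1 else 0)"

definition S_perms :: "nat \<Rightarrow> nat \<Rightarrow> (nat \<Rightarrow> int) \<Rightarrow> (nat \<Rightarrow> nat) set" where
  "S_perms m n lam =
     {\<sigma>. \<sigma> permutes {1..atypicality m n lam} \<and>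
         (\<forall>s \<in> {1..atypicality m n lam}. \<forall>t \<in> {1..atypicality m n lam}.
            s < t \<and> c_hat m n lam s t = 1 \<longrightarrow> inv \<sigma> s < inv \<sigma> t)}"

definition S_perms_rel :: "nat \<Rightarrow> nat \<Rightarrow> (nat \<Rightarrow> int) \<Rightarrow> (nat \<Rightarrow> int) \<Rightarrow> (nat \<Rightarrow> nat) set" where
  "S_perms_rel m n lam \<mu> =
     {\<sigma> \<in> S_perms m n lam.
        \<forall>s \<in> {1..atypicality m n lam}. atypical_tuple m n \<mu> s \<le> atypical_tuple m n lam (\<sigma> s)}"

definition perm_length :: "nat \<Rightarrow> (nat \<Rightarrow> nat) \<Rightarrow> nat" where
  "perm_length r \<sigma> = card {(s, t). s \<in> {1..r} \<and> t \<in> {1..r} \<and> s < t \<and> \<sigma> t < \<sigma> s}"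

definition S_poly :: "nat \<Rightarrow> nat \<Rightarrow> (nat \<Rightarrow> int) \<Rightarrow> (nat \<Rightarrow> int) \<Rightarrow> int poly" where
  "S_poly m n lam \<mu> =
     (\<Sum>\<sigma> \<in> S_perms_rel m n lam \<mu>. monom 1 (perm_length (atypicality m n lam) \<sigma>))"


section \<open>Raising operators and Kazhdan--Lusztig polynomials\<close>

text \<open>
  \<open>k_search a S ss s\<close> processes the indices in the list \<open>ss\<close> in turn, where \<open>a\<close> gives the atypical
  entries and \<open>S\<close> is the set of integers already in use, and returns the number \<open>k\<^sub>s\<close>.
\<close>

fun k_search :: "(nat \<Rightarrow> int) \<Rightarrow> int set \<Rightarrow> nat list \<Rightarrow> nat \<Rightarrow> int" where
  "k_search a S [] s = 0"
| "k_search a S (t # ts) s =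
     (let k = (LEAST k. a t < k \<and> k \<notin> S)
      in if s = t then k - a t else k_search a (insert k S) ts s)"

definition k_num :: "nat \<Rightarrow> nat \<Rightarrow> (nat \<Rightarrow> int) \<Rightarrow> nat \<Rightarrow> int" where
  "k_num m n lam s =
     k_search (atypical_tuple m n lam) (rho_shift m n lam ` {1..m+n})
       (rev (sort_key (atypical_tuple m n lam) [1..<atypicality m n lam + 1])) s"

definition raise_op :: "nat \<Rightarrow> nat \<Rightarrow> nat \<Rightarrow> (nat \<Rightarrow> int) \<Rightarrow> nat \<Rightarrow> int" where
  "raise_op m n s lam =
     (\<lambda>i. if i = atyp_row m n lam s \<or> i = m + atyp_col m n lam s
          then lam i + k_num m n lam s else lam i)"

text \<open>
  A raising operator does not move the atypical roots, so in the composition below the \<open>s\<close>-th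
  atypical root of every intermediate weight is that of \<open>\<mu>\<close>.  The operator with index \<open>r\<close> acts first.
\<close>

definition raise_theta :: "nat \<Rightarrow> nat \<Rightarrow> (nat \<Rightarrow> nat) \<Rightarrow> (nat \<Rightarrow> int) \<Rightarrow> nat \<Rightarrow> int" where
  "raise_theta m n \<theta> \<mu> =
     dominant_rep m n
       (foldr (\<lambda>s \<nu>. (raise_op m n s ^^ \<theta> s) \<nu>) [1..<atypicality m n \<mu> + 1] \<mu>)"

text \<open>
  Brundan's formula for Serganova's generalized Kazhdan--Lusztig polynomials, taken as definition.
  For dominant \<open>\<mu>\<close> the sum is finite: each raising operator increases the sum of the first \<open>m\<close>
  entries by at least \<open>1\<close>, and passing to the dominant representative preserves it.
\<close>

definition KL_poly :: "nat \<Rightarrow> nat \<Rightarrow> (nat \<Rightarrow> int) \<Rightarrow> (nat \<Rightarrow> int) \<Rightarrow> int poly" where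
  "KL_poly m n lam \<mu> =
     (if atypicality m n lam = atypicality m n \<mu>
      then \<Sum>\<theta> \<in> {\<theta> \<in> {1..atypicality m n \<mu>} \<rightarrow>\<^sub>E UNIV. raise_theta m n \<theta> \<mu> = lam}.
             monom 1 (\<Sum>s = 1..atypicality m n \<mu>. \<theta> s)
      else 0)"


section \<open>The functions \<open>Z\<^sub>q\<close>\<close>

definition step_fun :: "int \<Rightarrow> int poly" where
  "step_fun y = (if 0 \<le> y then 1 else 0)"

definition Z_admissible :: "nat \<Rightarrow> (nat \<Rightarrow> int) \<Rightarrow> (nat \<Rightarrow> int) \<Rightarrow> bool" where
  "Z_admissible r x b \<longleftrightarrow>
     mono_on {1..r} x \<and> mono_on {1..r} b \<and> (\<forall>s \<in> {1..r}. 1 \<le> b s \<and> b s \<le> int s)"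

text \<open>
  The tuples \<open>x\<close> and \<open>b\<close> have length \<open>r\<close>, given by their values on \<open>{1..r}\<close>.  With value \<open>1\<close> on
  empty tuples, the recursion produces the explicit formulas for \<open>r = 1, 2\<close> proved below.
\<close>

fun Z_fun :: "nat \<Rightarrow> (nat \<Rightarrow> int) \<Rightarrow> (nat \<Rightarrow> int) \<Rightarrow> int poly" where
  "Z_fun 0 x b = 1"
| "Z_fun (Suc r) x b =
     (if Z_admissible (Suc r) x b
      then Z_fun r x b +
        (\<Sum>i = nat (b (Suc r))..r.
           step_fun (x (i + 1) - x i - 1) *
           Z_fun r (\<lambda>j. if j < i then x j else x (j + 1) - 1) b * monom 1 (Suc r - i))
      else 0)"

lemma Z_fun_1:
  assumes "Z_admissible 1 x b"
  shows "Z_fun 1 x b = 1"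
proof -
  have "b 1 = 1" using assms by (auto simp: Z_admissible_def)
  then show ?thesis using assms by simp
qed

lemma Z_fun_2:
  assumes "Z_admissible 2 x b"
  shows "Z_fun 2 x b = 1 + step_fun (x 2 - x 1 - 1) * step_fun (1 - b 2) * monom 1 1"
proof -
  have "\<And>s. s \<in> {1..2} \<Longrightarrow> 1 \<le> b s \<and> b s \<le> int s"
    using assms by (auto simp: Z_admissible_def)
  from this[of 1] this[of 2] have b: "b 1 = 1" "b 2 = 1 \<or> b 2 = 2"
    by auto
  have "Z_admissible 1 x b"
    using b by (auto simp: Z_admissible_def mono_on_def)
  then have 1: "Z_fun (Suc 0) x b = 1"
    using Z_fun_1[of x b] by (simp del: Z_fun.simps)
  have "Z_admissible 1 (\<lambda>j. if j < Suc 0 then x j else x (j + 1) - 1) b"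
    using b by (auto simp: Z_admissible_def mono_on_def)
  then have 2: "Z_fun (Suc 0) (\<lambda>j. if j < Suc 0 then x j else x (j + 1) - 1) b = 1"
    using Z_fun_1 by (metis One_nat_def)
  have eq: "Z_fun 2 x b = Z_fun (Suc 0) x b +
    (\<Sum>i = nat (b 2)..1. step_fun (x (i + 1) - x i - 1) *
       Z_fun (Suc 0) (\<lambda>j. if j < i then x j else x (j + 1) - 1) b * monom 1 (2 - i))"
    using assms by (simp add: numeral_2_eq_2 del: Z_fun.simps(1) Z_fun.simps(2)[of 0])
  from b(2) show ?thesis
  proof
    assume "b 2 = 1"
    with eq 1 2 show ?thesis
      by (simp add: step_fun_def numeral_2_eq_2 del: Z_fun.simps)
  next
    assume "b 2 = 2"
    with eq 1 show ?thesis by (simp add: step_fun_def del: Z_fun.simps)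
  qed
qed

definition b_tuple :: "nat \<Rightarrow> nat \<Rightarrow> (nat \<Rightarrow> int) \<Rightarrow> (nat \<Rightarrow> int) \<Rightarrow> nat \<Rightarrow> int" where
  "b_tuple m n lam \<mu> s =
     int (Min {i \<in> {1..atypicality m n lam}. atypical_tuple m n \<mu> s \<le> atypical_tuple m n lam i})"


section \<open>Laurent polynomials\<close>

text \<open>
  Identities involving negative powers of \<open>q\<close> are stated in the ring of formal Laurent series,
  with \<open>q ^ i\<close> rendered as \<^term>\<open>fls_X_intpow i\<close>.
\<close>

definition poly_to_fls :: "int poly \<Rightarrow> int fls" where
  "poly_to_fls p = fps_to_fls (fps_of_poly p)"

definition poly_at_q_powi :: "int poly \<Rightarrow> int \<Rightarrow> int fls" where
  "poly_at_q_powi p i = poly (map_poly fls_const p) (fls_X_intpow i)"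

end

theory Submission
  imports Defs
begin

text \<open>
  A weight of fixed typical tuple is a configuration of \<open>r\<close> particles, its atypical entries, among
  the integers that are not typical entries.  Walk along the integers, going up at vacancies, down at
  particles and staying level at typical entries: a position is free for a set of particles if it is
  vacant and the walk grows past its running maximum there, which are the vacancies not matched with
  a particle when particles and vacancies are read as opening and closing brackets.  The greedy search
  in the raising operator computes these matchings, so the operator with index \<open>s\<close> moves particle
  \<open>s\<close> to the next position that is free for the particles \<open>s + 1, \<dots>, r\<close>, and raises the walk at
  particle \<open>s\<close> by exactly \<open>1\<close>.  Hence \<open>\<theta>\<close> and the final positions determine each other, and the final
  positions that fill the configuration of \<open>lam\<close> are its rearrangements by a permutation \<open>\<sigma>\<close> with
  every particle at or to the right of its starting point and at a free position.  The latter means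
  that \<open>\<sigma>\<close> respects the nesting of matched brackets in \<open>lam\<close>, i.e. \<open>\<sigma>\<close> lies in \<open>S\<close>.  A jump over
  \<open>k\<close> particles has length \<open>2 k + 1\<close> and creates \<open>k\<close> inversions, so \<open>|\<theta>|\<close> is the total displacement
  minus \<open>2 \<ell>(\<sigma>)\<close>.  The recursion for \<open>Z\<^sub>q\<close> comes from sorting these permutations by their last value.
\<close>

section \<open>Free positions\<close>

text \<open>The coordinate of \<open>z\<close> once the typical entries are collapsed. It is the
  natural scale here: by \<open>height_eq\<close>, heights are this coordinate at the atypical
  entries, minus the index.\<close>

definition compress :: "int set \<Rightarrow> int \<Rightarrow> int" where
  "compress T z = z - int (card {t \<in> T. t < z})"

text \<open>The factor 2 turns the upward step that \<open>compress\<close> makes at a particle into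
  a downward step.\<close>

definition walk :: "int set \<Rightarrow> int set \<Rightarrow> int \<Rightarrow> int" where
  "walk T Q z = compress T z - 2 * int (card {q \<in> Q. q < z})"

text \<open>A weak inequality suffices: the step up from the vacant \<open>z\<close> then carries
  the walk strictly past all earlier values.\<close>

definition free :: "int set \<Rightarrow> int set \<Rightarrow> int set" where
  "free T Q = {z. z \<notin> T \<and> z \<notin> Q \<and> (\<forall>q<z. walk T Q q \<le> walk T Q z)}"

definition next_free :: "int set \<Rightarrow> int set \<Rightarrow> int \<Rightarrow> int" where
  "next_free T Q x = (LEAST z. x < z \<and> z \<in> free T Q)"

section \<open>Step rules for the walk and the order of free positions\<close>

lemma card_less_Suc:
  fixes A :: "int set"
  assumes "finite A"
  shows "int (card {a \<in> A. a < z + 1}) = int (card {a \<in> A. a < z}) + (if z \<in> A then 1 else 0)"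
proof (cases "z \<in> A")
  case True
  then have "{a \<in> A. a < z + 1} = insert z {a \<in> A. a < z}" by auto
  then show ?thesis using assms True by simp
next
  case False
  then have "{a \<in> A. a < z + 1} = {a \<in> A. a < z}"
    by (metis order_le_less zless_add1_eq)
  then show ?thesis using False by simp
qed

lemma compress_Suc:
  assumes "finite T"
  shows "compress T (z + 1) = compress T z + (if z \<in> T then 0 else 1)"
  using card_less_Suc[OF assms, of z] by (simp add: compress_def)

lemma walk_Suc:
  assumes "finite T" "finite Q" "T \<inter> Q = {}"
  shows "walk T Q (z + 1) = walk T Q z + (if z \<in> T then 0 else if z \<in> Q then -1 else 1)"
  using card_less_Suc[OF assms(2), of z] compress_Suc[OF assms(1), of z] assms(3)
  by (auto simp: walk_def)

lemma compress_mono: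
  assumes "finite T" "x \<le> y"
  shows "compress T x \<le> compress T y"
  using assms(2)
proof (induction y rule: int_ge_induct)
  case (step i)
  then show ?case using compress_Suc[OF assms(1), of i] by (auto split: if_splits)
qed simp

lemma compress_strict_mono:
  assumes "finite T" "x < y" "x \<notin> T"
  shows "compress T x < compress T y"
  using compress_mono[OF assms(1), of "x + 1" y] compress_Suc[OF assms(1), of x] assms(2,3)
  by simp

lemma free_empty: "finite T \<Longrightarrow> free T {} = - T"
  using compress_mono[of T] by (auto simp: free_def walk_def)

text \<open>The walk steps up right after \<open>x\<close>, and its value at the free position
  \<open>y\<close> dominates the one at \<open>x + 1\<close>. So a free position can be recovered
  from its walk value.\<close>

lemma free_walk_less:
  assumes "finite T" "finite Q" "T \<inter> Q = {}" "x \<in> free T Q" "y \<in> free T Q" "x < y"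
  shows "walk T Q x < walk T Q y"
proof -
  have "walk T Q (x + 1) = walk T Q x + 1"
    using walk_Suc[OF assms(1-3), of x] assms(4) by (simp add: free_def)
  moreover have "walk T Q (x + 1) \<le> walk T Q y"
    using assms(5,6) by (cases "x + 1 = y") (auto simp: free_def)
  ultimately show ?thesis by simp
qed

lemma free_walk_inj:
  assumes "finite T" "finite Q" "T \<inter> Q = {}" "x \<in> free T Q" "y \<in> free T Q"
    "walk T Q x = walk T Q y"
  shows "x = y"
  using free_walk_less[OF assms(1-3), of x y] free_walk_less[OF assms(1-3), of y x] assms(4-6)
  by (cases x y rule: linorder_cases) auto

text \<open>The integers are not well-ordered, so \<open>LEAST\<close> needs a lower bound
  \<open>x\<close> and a witness \<open>k\<close>; the minimum over the finite interval
  \<open>{x..k}\<close> is then the global one.\<close>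

lemma int_Least:
  fixes P :: "int \<Rightarrow> bool"
  assumes "P k" and lower: "\<And>z. P z \<Longrightarrow> x \<le> z"
  shows "P (Least P)" and "P z \<Longrightarrow> Least P \<le> z"
proof -
  let ?A = "{z \<in> {x..k}. P z}"
  have "?A \<subseteq> {x..k}" by auto
  then have A: "finite ?A" "?A \<noteq> {}" using assms by (auto intro: finite_subset)
  then have min: "Min ?A \<in> ?A" by (rule Min_in)
  have le: "Min ?A \<le> z" if "P z" for z
  proof (cases "z \<le> k")
    case True
    then show ?thesis using A lower that by (intro Min_le) auto
  next
    case False
    then show ?thesis using min by auto
  qed
  have "Least P = Min ?A" using min le by (intro Least_equality) auto
  then show "P (Least P)" "P z \<Longrightarrow> Least P \<le> z" using min le by auto
qed

lemma next_free_props: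
  assumes "finite (- free T Q)"
  shows "x < next_free T Q x" and "next_free T Q x \<in> free T Q"
    and "\<And>z. x < z \<Longrightarrow> z \<in> free T Q \<Longrightarrow> next_free T Q x \<le> z"
proof -
  have "infinite {x<..}" by (rule infinite_Ioi)
  then obtain k where "k \<in> {x<..}" "k \<notin> - free T Q"
    using assms by (metis finite_subset subsetI)
  then have k: "x < k \<and> k \<in> free T Q" by simp
  note L = int_Least[of "\<lambda>z. x < z \<and> z \<in> free T Q", OF k, of x]
  show "x < next_free T Q x" "next_free T Q x \<in> free T Q"
    "\<And>z. x < z \<Longrightarrow> z \<in> free T Q \<Longrightarrow> next_free T Q x \<le> z"
    using L unfolding next_free_def by auto
qed

text \<open>
  The running maximum of the walk grows in unit steps, and the free positions are those from which
  it grows.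
\<close>

lemma walk_next_free:
  assumes fin: "finite T" "finite Q" "T \<inter> Q = {}" and cof: "finite (- free T Q)"
    and x: "x \<in> free T Q"
  shows "walk T Q (next_free T Q x) = walk T Q x + 1"
proof (rule ccontr)
  let ?k = "next_free T Q x"
  assume ne: "\<not> ?thesis"
  note k = next_free_props[OF cof, of x]
  have x1: "walk T Q (x + 1) = walk T Q x + 1"
    using walk_Suc[OF fin, of x] x by (simp add: free_def)
  have gt: "walk T Q ?k > walk T Q x + 1"
    using free_walk_less[OF fin x k(2,1)] ne by simp
  \<comment> \<open>The first \<open>w\<close> beyond \<open>x\<close> where the walk exceeds its
    value at \<open>x\<close> by more than 1 is reached by an upward step, so \<open>w - 1\<close>
    is free and lies between \<open>x\<close> and \<open>?k\<close>, against the choice of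
    \<open>?k\<close>.\<close>
  define P where "P w \<longleftrightarrow> x < w \<and> walk T Q w > walk T Q x + 1" for w
  define w where "w = Least P"
  have Pk: "P ?k" using k gt by (simp add: P_def)
  have lower: "x \<le> z" if "P z" for z using that by (simp add: P_def)
  have w: "P w" "w \<le> ?k" using int_Least[of P, OF Pk lower] Pk by (auto simp: w_def)
  have w_min: "walk T Q q \<le> walk T Q x + 1" if "x < q" "q < w" for q
    using int_Least(2)[of P, OF Pk lower, of q] that by (force simp: P_def w_def)
  have "w \<noteq> x + 1" using w(1) x1 by (auto simp: P_def)
  then have xw: "x < w - 1" using w(1) by (simp add: P_def)
  have up: "w - 1 \<notin> T" "w - 1 \<notin> Q" "walk T Q (w - 1) = walk T Q x + 1"
    using walk_Suc[OF fin, of "w - 1"] w(1) w_min[OF xw] by (auto simp: P_def split: if_splits)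
  have "walk T Q q \<le> walk T Q (w - 1)" if "q < w - 1" for q
  proof -
    consider "q < x" | "q = x" | "x < q" by linarith
    then show ?thesis
    proof cases
      case 1
      then have "walk T Q q \<le> walk T Q x" using x by (auto simp: free_def)
      then show ?thesis using up by simp
    qed (use up w_min that in auto)
  qed
  then have "w - 1 \<in> free T Q" using up by (auto simp: free_def)
  then show False using k(3)[OF xw] w(2) by auto
qed

lemma walk_insert_Min:
  assumes "finite Q" "\<forall>q\<in>Q. x < q"
  shows "walk T (insert x Q) z = walk T Q z - (if x < z then 2 else 0)"
proof (cases "x < z")
  case True
  then have "{q \<in> insert x Q. q < z} = insert x {q \<in> Q. q < z}" by auto
  moreover have "x \<notin> {q \<in> Q. q < z}" using assms(2) by auto
  ultimately show ?thesis using assms(1) True by (simp add: walk_def)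
next
  case False
  then have "{q \<in> insert x Q. q < z} = {q \<in> Q. q < z}" by auto
  then show ?thesis using False by (simp add: walk_def)
qed

lemma walk_below:
  assumes "\<forall>q\<in>Q. z \<le> q"
  shows "walk T Q z = compress T z"
proof -
  have "{q \<in> Q. q < z} = {}" using assms by force
  then show ?thesis unfolding walk_def by (simp only: card.empty)
qed

text \<open>Left of all particles the walk is the monotone function \<open>compress\<close>, so
  vacancy alone makes a position free.\<close>

lemma below_free:
  assumes "finite T" "\<forall>q\<in>Q. x < q" "x \<notin> T"
  shows "x \<in> free T Q"
proof -
  have "walk T Q q \<le> walk T Q x" if "q < x" for q
    using compress_mono[OF assms(1), of q x] assms(2) that
      walk_below[of Q x T] walk_below[of Q q T] by fastforce
  then show ?thesis using assms by (auto simp: free_def)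
qed

text \<open>A new leftmost particle \<open>x\<close> lowers the walk by 2 beyond \<open>x\<close>.
  It occupies one free position and is matched with the next one, where the walk was only 1 above
  its value at \<open>x\<close>; every later free position is at least 2 above and survives.\<close>

lemma free_insert_Min:
  assumes fin: "finite T" "finite Q" "T \<inter> Q = {}" and cof: "finite (- free T Q)"
    and min: "\<forall>q\<in>Q. x < q" and xT: "x \<notin> T"
  shows "free T (insert x Q) = free T Q - {x, next_free T Q x}"
proof -
  let ?k = "next_free T Q x"
  note k = next_free_props[OF cof, of x]
  have x: "x \<in> free T Q" using below_free[OF fin(1) min xT] .
  have wk: "walk T Q ?k = walk T Q x + 1" using walk_next_free[OF fin cof x] .
  have wi: "walk T (insert x Q) z = walk T Q z - (if x < z then 2 else 0)" for z
    using walk_insert_Min[OF fin(2) min] .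
  have lex: "walk T Q q \<le> walk T Q x" if "q \<le> x" for q
    using x that by (cases "q = x") (auto simp: free_def)
  have "z \<in> free T (insert x Q) \<longleftrightarrow> z \<in> free T Q - {x, ?k}" for z
  proof
    assume z: "z \<in> free T (insert x Q)"
    then have zz: "z \<notin> T" "z \<notin> Q" "z \<noteq> x" by (auto simp: free_def)
    have le: "walk T (insert x Q) q \<le> walk T (insert x Q) z" if "q < z" for q
      using z that by (auto simp: free_def)
    \<comment> \<open>If \<open>q\<close> and \<open>z\<close> lie on different sides of
      \<open>x\<close>, only the value at \<open>z\<close> is shifted, and the comparison passes
      through the value at \<open>x\<close>.\<close>
    have "walk T Q q \<le> walk T Q z" if "q < z" for q
    proof (cases "x < z \<and> q \<le> x")
      case True
      then show ?thesis using lex[of q] le[of x] wi[of x] wi[of z] by auto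
    next
      case False
      then show ?thesis using le[OF that] wi[of q] wi[of z] that by (auto split: if_splits)
    qed
    moreover have "z \<noteq> ?k"
    proof
      assume "z = ?k"
      then show False using le[of x] wi[of x] wi[of z] wk k(1) by auto
    qed
    ultimately show "z \<in> free T Q - {x, ?k}" using zz by (auto simp: free_def)
  next
    assume z: "z \<in> free T Q - {x, ?k}"
    have le: "walk T Q q \<le> walk T Q z" if "q < z" for q
      using z that by (auto simp: free_def)
    have "walk T (insert x Q) q \<le> walk T (insert x Q) z" if "q < z" for q
    proof (cases "x < z \<and> q \<le> x")
      case True
      \<comment> \<open>Free positions have strictly increasing walk values, so \<open>z\<close>
        lies at least 2 above \<open>x\<close>, which absorbs the drop.\<close>
      then have "?k < z" using k(3)[of z] z by auto
      then have "walk T Q ?k < walk T Q z" using free_walk_less[OF fin k(2)] z by auto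
      then show ?thesis using lex[of q] wi[of q] wi[of z] wk True by auto
    next
      case False
      then show ?thesis using le[OF that] wi[of q] wi[of z] that by (auto split: if_splits)
    qed
    then show "z \<in> free T (insert x Q)" using z by (auto simp: free_def)
  qed
  then show ?thesis by blast
qed

text \<open>Adding the particles from right to left removes two free positions each time.\<close>

lemma cofinite_free:
  assumes "finite Q" "finite T" "T \<inter> Q = {}"
  shows "finite (- free T Q)"
  using assms
proof (induction Q rule: finite_linorder_min_induct)
  case empty
  then show ?case by (simp add: free_empty)
next
  case (insert x Q)
  then have "free T (insert x Q) = free T Q - {x, next_free T Q x}"
    by (intro free_insert_Min) auto
  moreover have "finite (- free T Q)" using insert by auto
  moreover have "- (free T Q - {x, next_free T Q x}) = - free T Q \<union> {x, next_free T Q x}"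
    by auto
  ultimately show ?case by simp
qed

text \<open>The greedy search at \<open>x\<close> sees only the particles right of \<open>x\<close>,
  whereas freeness refers to all of \<open>Q\<close>. If \<open>x\<close> is free, the particles
  left of it are matched left of it: beyond \<open>x\<close> the two walks differ by the constant
  \<open>c\<close>, and both are bounded by their value at \<open>x\<close> up to there.\<close>

lemma next_free_upper_part:
  assumes "finite T" "finite Q" and x: "x \<in> free T Q"
  shows "next_free T {q \<in> Q. x < q} x = next_free T Q x"
proof -
  let ?Q = "{q \<in> Q. x < q}"
  define c where "c = 2 * int (card {q \<in> Q. q < x})"
  have xQ: "x \<notin> Q" "x \<notin> T" using x by (auto simp: free_def)
  have w_le: "walk T ?Q z = compress T z" if "z \<le> x" for z
    using walk_below[of ?Q z T] that by auto
  have w: "walk T Q z = walk T ?Q z - c" if "x < z" for z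
  proof -
    have "{q \<in> Q. q < z} = {q \<in> Q. q < x} \<union> {q \<in> ?Q. q < z}"
      using xQ that by (auto simp: not_less order_le_less)
    moreover have "card \<dots> = card {q \<in> Q. q < x} + card {q \<in> ?Q. q < z}"
      by (rule card_Un_disjoint) (use assms in auto)
    ultimately show ?thesis by (simp add: walk_def c_def)
  qed
  have wx: "walk T Q x = walk T ?Q x - c"
    using w_le[of x] by (simp add: walk_def c_def)
  have lex: "walk T Q q \<le> walk T Q x" if "q \<le> x" for q
    using x that by (cases "q = x") (auto simp: free_def)
  have lex': "walk T ?Q q \<le> walk T ?Q x" if "q \<le> x" for q
    using w_le[of q] w_le[of x] compress_mono[OF assms(1) that] that by simp
  have "z \<in> free T ?Q \<longleftrightarrow> z \<in> free T Q" if z: "x < z" for z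
  proof -
    have "(\<forall>q<z. walk T ?Q q \<le> walk T ?Q z) \<longleftrightarrow> (\<forall>q<z. walk T Q q \<le> walk T Q z)"
    proof (intro iffI allI impI)
      fix q assume A: "\<forall>q<z. walk T ?Q q \<le> walk T ?Q z" and q: "q < z"
      show "walk T Q q \<le> walk T Q z"
      proof (cases "x < q")
        case True
        then show ?thesis using A q w z by auto
      next
        case False
        then show ?thesis using A[rule_format, OF z] lex[of q] w[OF z] wx by auto
      qed
    next
      fix q assume A: "\<forall>q<z. walk T Q q \<le> walk T Q z" and q: "q < z"
      show "walk T ?Q q \<le> walk T ?Q z"
      proof (cases "x < q")
        case True
        then show ?thesis using A[rule_format, OF q] w[of q] w[of z] z by auto
      next
        case False
        then show ?thesis using A[rule_format, OF z] lex'[of q] w[OF z] wx by auto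
      qed
    qed
    then show ?thesis using z by (auto simp: free_def)
  qed
  then have "(\<lambda>z. x < z \<and> z \<in> free T ?Q) = (\<lambda>z. x < z \<and> z \<in> free T Q)" by auto
  then show ?thesis by (simp add: next_free_def)
qed

text \<open>\<open>Q\<close> holds the particles already processed and \<open>ts\<close> the pending
  ones. Since \<open>ts\<close> runs from right to left, each processed particle is leftmost in the
  new \<open>Q\<close>, and by \<open>free_insert_Min\<close> adding the value found to
  \<open>S\<close> preserves the stated form of \<open>S\<close>.\<close>

lemma k_search_eq_next_free:
  assumes "finite T" "finite Q" "T \<inter> Q = {}" "sorted_wrt (\<lambda>s t. p t < p s) ts"
    "\<forall>t \<in> set ts. p t \<notin> T" "\<forall>t \<in> set ts. \<forall>q \<in> Q. p t < q"
    "S = - free T Q \<union> p ` set ts" "s \<in> set ts"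
  shows "p s + k_search p S ts s = next_free T (Q \<union> p ` {t \<in> set ts. p s < p t}) (p s)"
  using assms
proof (induction ts arbitrary: S Q)
  case (Cons t ts)
  note cof = cofinite_free[OF Cons.prems(2,1,3)]
  let ?k = "LEAST k. p t < k \<and> k \<notin> S"
  have lt: "\<forall>u \<in> set ts. p u < p t" using Cons.prems(4) by auto
  \<comment> \<open>Pending particles lie at or left of \<open>p t\<close>, so beyond
    \<open>p t\<close> the set \<open>S\<close> consists exactly of the positions that are not
    free.\<close>
  have "p t < k \<and> k \<notin> S \<longleftrightarrow> p t < k \<and> k \<in> free T Q" for k
    using lt Cons.prems(7) by force
  then have k: "?k = next_free T Q (p t)" by (simp add: next_free_def)
  show ?case
  proof (cases "s = t")
    case True
    then have "{u \<in> set (t # ts). p s < p u} = {}" using lt by force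
    then have "Q \<union> p ` {u \<in> set (t # ts). p s < p u} = Q" by blast
    then show ?thesis using k True by (simp del: list.set)
  next
    case False
    then have s: "s \<in> set ts" using Cons.prems(8) by simp
    have ins: "free T (insert (p t) Q) = free T Q - {p t, next_free T Q (p t)}"
      using Cons.prems cof by (intro free_insert_Min) auto
    have "p s + k_search p (insert ?k S) ts s =
        next_free T (insert (p t) Q \<union> p ` {u \<in> set ts. p s < p u}) (p s)"
    proof (rule Cons.IH)
      show "insert ?k S = - free T (insert (p t) Q) \<union> p ` set ts"
        using ins k Cons.prems(7) by auto
    qed (use Cons.prems s lt in auto)
    moreover have "insert (p t) Q \<union> p ` {u \<in> set ts. p s < p u}
        = Q \<union> p ` {u \<in> set (t # ts). p s < p u}"
      using lt s by auto
    ultimately show ?thesis using False by (simp add: Let_def)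
  qed
qed simp

section \<open>Dominant weights and their entries\<close>

abbreviation left_entries :: "nat \<Rightarrow> nat \<Rightarrow> (nat \<Rightarrow> int) \<Rightarrow> int set" where
  "left_entries m n lam \<equiv> rho_shift m n lam ` {1..m}"

abbreviation right_entries :: "nat \<Rightarrow> nat \<Rightarrow> (nat \<Rightarrow> int) \<Rightarrow> int set" where
  "right_entries m n lam \<equiv> rho_shift m n lam ` {m+1..m+n}"

text \<open>A symmetric difference, because an entry is atypical exactly when it occurs on both
  sides.\<close>

definition typical_entries :: "nat \<Rightarrow> nat \<Rightarrow> (nat \<Rightarrow> int) \<Rightarrow> int set" where
  "typical_entries m n lam =
     (left_entries m n lam - right_entries m n lam) \<union> (right_entries m n lam - left_entries m n lam)"

lemma finite_typical_entries: "finite (typical_entries m n lam)"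
  by (simp add: typical_entries_def)

section \<open>Roots and typical tuples through entry sets\<close>

lemma right_entries_conv: "right_entries m n lam = (\<lambda>\<zeta>. rho_shift m n lam (m + \<zeta>)) ` {1..n}"
proof -
  have "{m+1..m+n} = (\<lambda>\<zeta>. m + \<zeta>) ` {1..n}" by simp
  then show ?thesis by (simp only: image_image)
qed

lemma finite_atyp_roots: "finite (atyp_roots m n lam)"
proof (rule finite_subset)
  show "atyp_roots m n lam \<subseteq> {1..m} \<times> {1..n}" by (auto simp: atyp_roots_def)
qed simp

lemma fst_atyp_roots: "fst ` atyp_roots m n lam = {i \<in> {1..m}. rho_shift m n lam i \<in> right_entries m n lam}"
proof -
  have "i \<in> fst ` atyp_roots m n lam \<longleftrightarrow>
      i \<in> {1..m} \<and> rho_shift m n lam i \<in> right_entries m n lam" for i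
  proof -
    have "i \<in> fst ` atyp_roots m n lam \<longleftrightarrow> (\<exists>\<zeta>. (i, \<zeta>) \<in> atyp_roots m n lam)" by force
    then show ?thesis unfolding right_entries_conv by (auto simp: atyp_roots_def)
  qed
  then show ?thesis by blast
qed

lemma snd_atyp_roots:
  "snd ` atyp_roots m n lam = {\<zeta> \<in> {1..n}. rho_shift m n lam (m + \<zeta>) \<in> left_entries m n lam}"
proof -
  have "\<zeta> \<in> snd ` atyp_roots m n lam \<longleftrightarrow>
      \<zeta> \<in> {1..n} \<and> rho_shift m n lam (m + \<zeta>) \<in> left_entries m n lam" for \<zeta>
  proof -
    have "\<zeta> \<in> snd ` atyp_roots m n lam \<longleftrightarrow> (\<exists>i. (i, \<zeta>) \<in> atyp_roots m n lam)" by force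
    also have "\<dots> \<longleftrightarrow> \<zeta> \<in> {1..n} \<and> (\<exists>i \<in> {1..m}. rho_shift m n lam i = rho_shift m n lam (m + \<zeta>))"
      by (auto simp: atyp_roots_def)
    finally show ?thesis
      by (simp only: image_iff eq_commute[of "rho_shift m n lam (m + \<zeta>)"])
  qed
  then show ?thesis by blast
qed

lemma set_typical_tuple:
  "set (fst (typical_tuple m n lam)) = left_entries m n lam - right_entries m n lam"
  "set (snd (typical_tuple m n lam)) = right_entries m n lam - left_entries m n lam"
proof -
  show "set (fst (typical_tuple m n lam)) = left_entries m n lam - right_entries m n lam"
    unfolding typical_tuple_def fst_atyp_roots by (auto simp: less_Suc_eq_le)
  show "set (snd (typical_tuple m n lam)) = right_entries m n lam - left_entries m n lam"
    unfolding typical_tuple_def snd_atyp_roots right_entries_conv by (auto simp: less_Suc_eq_le)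
qed

text \<open>Strictly increasing integers grow by at least 1 per step. This converts strict order of
  shifted entries into weak order after subtracting \<open>rho\<close>, and likewise for heights
  after subtracting the index.\<close>

lemma strict_gap:
  fixes g :: "nat \<Rightarrow> int"
  assumes "i \<le> j" "\<And>k. i \<le> k \<Longrightarrow> k < j \<Longrightarrow> g k < g (Suc k)"
  shows "int j - int i \<le> g j - g i"
  using assms
proof (induction j rule: dec_induct)
  case (step k)
  then show ?case using step.prems[of k] step.IH by fastforce
qed simp

text \<open>Sort \<open>L\<close> decreasingly and \<open>R\<close> increasingly and subtract
  \<open>rho\<close>. Existence is what makes the definite description in
  \<open>dominant_rep\<close> denote a weight.\<close>

lemma dominant_weight_exists:
  assumes "finite L" "card L = m" "finite R" "card R = n"
  shows "\<exists>lam \<in> dominant_weights m n. left_entries m n lam = L \<and> right_entries m n lam = R"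
proof -
  define l where "l = rev (sorted_list_of_set L)"
  define u where "u = sorted_list_of_set R"
  define g where "g i = (if i \<in> {1..m} then l ! (i - 1)
    else if i \<in> {m+1..m+n} then u ! (i - (m + 1)) else 0)" for i
  define lam where "lam i = g i - rho m n i" for i
  have l: "length l = m" "set l = L" "sorted_wrt (>) l"
    and u: "length u = n" "set u = R" "sorted_wrt (<) u"
    using assms by (auto simp: l_def u_def sorted_wrt_rev)
  have shift: "rho_shift m n lam = g" by (auto simp: rho_shift_def lam_def)
  have "g ` {1..m} = (\<lambda>i. l ! (i - 1)) ` {1..m}" by (auto simp: g_def)
  also have "\<dots> = (!) l ` (\<lambda>i. i - 1) ` {1..m}" by (simp add: image_image)
  also have "(\<lambda>i. i - 1) ` {1..m} = {0..<m}"
  proof -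
    have "x \<in> (\<lambda>i. i - 1) ` {1..m}" if "x < m" for x
      by (rule image_eqI[of _ _ "Suc x"]) (use that in auto)
    then show ?thesis by auto
  qed
  also have "(!) l ` {0..<m} = L" using nth_image[of m l] l by simp
  finally have L: "g ` {1..m} = L" .
  have "g ` {m+1..m+n} = (\<lambda>i. u ! (i - (m + 1))) ` {m+1..m+n}" by (auto simp: g_def)
  also have "\<dots> = (!) u ` (\<lambda>i. i - (m + 1)) ` {m+1..m+n}" by (simp add: image_image)
  also have "(\<lambda>i. i - (m + 1)) ` {m+1..m+n} = {0..<n}"
  proof -
    have "x \<in> (\<lambda>i. i - (m + 1)) ` {m+1..m+n}" if "x < n" for x
      by (rule image_eqI[of _ _ "x + (m + 1)"]) (use that in auto)
    then show ?thesis by auto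
  qed
  also have "(!) u ` {0..<n} = R" using nth_image[of n u] u by simp
  finally have R: "g ` {m+1..m+n} = R" .
  have "lam j \<le> lam i" if "i \<in> {1..m}" "j \<in> {1..m}" "i \<le> j" for i j
  proof -
    have "int j - int i \<le> (- g j) - (- g i)"
    proof (rule strict_gap[OF that(3)])
      fix k assume "i \<le> k" "k < j"
      then show "- g k < - g (Suc k)"
        using that sorted_wrt_nth_less[OF l(3), of "k - 1" k] l(1) by (auto simp: g_def)
    qed
    then show ?thesis using that by (simp add: lam_def rho_def)
  qed
  moreover have "lam i \<le> lam j" if "i \<in> {m+1..m+n}" "j \<in> {m+1..m+n}" "i \<le> j" for i j
  proof -
    have "int j - int i \<le> g j - g i"
    proof (rule strict_gap[OF that(3)])
      fix k assume "i \<le> k" "k < j"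
      then show "g k < g (Suc k)"
        using that sorted_wrt_nth_less[OF u(3), of "k - (m + 1)" "k - m"] u(1)
        by (auto simp: g_def)
    qed
    then show ?thesis using that by (simp add: lam_def rho_def)
  qed
  moreover have "lam i = 0" if "i \<notin> {1..m+n}" for i
    using that by (auto simp: lam_def g_def rho_def)
  ultimately have "lam \<in> dominant_weights m n"
    by (auto simp: dominant_weights_def integral_weights_def monotone_on_def)
  then show ?thesis using L R shift by metis
qed

text \<open>With distinct entries on each side, an element of the Weyl group is a matching of equal
  entries, so an orbit amounts to a pair of entry sets.\<close>

lemma dot_orbit_iff:
  assumes "lam \<in> integral_weights m n" "\<nu> \<in> integral_weights m n"
    and inj: "inj_on (rho_shift m n \<nu>) {1..m}" "inj_on (rho_shift m n \<nu>) {m+1..m+n}"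
    and injl: "inj_on (rho_shift m n lam) {1..m}" "inj_on (rho_shift m n lam) {m+1..m+n}"
  shows "(\<exists>w \<in> weyl_group m n. lam = dot_action m n w \<nu>) \<longleftrightarrow>
    left_entries m n \<nu> = left_entries m n lam \<and> right_entries m n \<nu> = right_entries m n lam"
proof
  assume "\<exists>w \<in> weyl_group m n. lam = dot_action m n w \<nu>"
  then obtain w where w: "w permutes {1..m+n}" "w ` {1..m} = {1..m}" "lam = dot_action m n w \<nu>"
    by (auto simp: weyl_group_def)
  have eq: "rho_shift m n lam i = rho_shift m n \<nu> (inv w i)" for i
    using w(3) by (simp add: dot_action_def rho_shift_def)
  have bij: "bij w" using w(1) permutes_bij by blast
  have l: "inv w ` {1..m} = {1..m}" using w(2) bij by (metis bij_is_inj image_inv_f_f)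
  have "{m+1..m+n} = {1..m+n} - {1..m}" by auto
  moreover have "inv w ` ({1..m+n} - {1..m}) = inv w ` {1..m+n} - inv w ` {1..m}"
    by (rule image_set_diff) (use bij bij_imp_bij_inv bij_is_inj in blast)
  ultimately have r: "inv w ` {m+1..m+n} = {m+1..m+n}"
    using l permutes_image[OF permutes_inv[OF w(1)]] by simp
  show "left_entries m n \<nu> = left_entries m n lam \<and> right_entries m n \<nu> = right_entries m n lam"
  proof
    have "left_entries m n lam = rho_shift m n \<nu> ` (inv w ` {1..m})"
      unfolding image_image eq ..
    then show "left_entries m n \<nu> = left_entries m n lam" using l by simp
    have "right_entries m n lam = rho_shift m n \<nu> ` (inv w ` {m+1..m+n})"
      unfolding image_image eq ..
    then show "right_entries m n \<nu> = right_entries m n lam" using r by simp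
  qed
next
  assume sets: "left_entries m n \<nu> = left_entries m n lam \<and> right_entries m n \<nu> = right_entries m n lam"
  define f where "f A i = inv_into A (rho_shift m n \<nu>) (rho_shift m n lam i)" for A i
  have bij: "bij_betw (f A) A A"
    if "inj_on (rho_shift m n \<nu>) A" "inj_on (rho_shift m n lam) A"
      "rho_shift m n \<nu> ` A = rho_shift m n lam ` A" for A
  proof -
    have "bij_betw (rho_shift m n lam) A (rho_shift m n \<nu> ` A)"
      using that by (simp add: bij_betw_def)
    moreover have "bij_betw (inv_into A (rho_shift m n \<nu>)) (rho_shift m n \<nu> ` A) A"
      using that(1) by (rule inj_on_imp_bij_betw[THEN bij_betw_inv_into])
    ultimately have "bij_betw (inv_into A (rho_shift m n \<nu>) \<circ> rho_shift m n lam) A A"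
      by (rule bij_betw_trans)
    then show ?thesis by (simp add: f_def[abs_def] comp_def)
  qed
  have f: "rho_shift m n \<nu> (f A i) = rho_shift m n lam i"
    if "rho_shift m n \<nu> ` A = rho_shift m n lam ` A" "i \<in> A" for A i
    unfolding f_def by (rule f_inv_into_f) (use that in auto)
  \<comment> \<open>\<open>v\<close> sends a position of \<open>lam\<close> to the position of \<nu>
    on the same side with the same shifted entry. The dot action precomposes with an inverse, so the
    group element is \<open>inv v\<close>.\<close>
  define v where "v i = (if i \<in> {1..m} then f {1..m} i
    else if i \<in> {m+1..m+n} then f {m+1..m+n} i else i)" for i
  have "bij_betw v {1..m} {1..m} = bij_betw (f {1..m}) {1..m} {1..m}"
    by (rule bij_betw_cong) (auto simp: v_def)
  then have b1: "bij_betw v {1..m} {1..m}"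
    using bij[OF inj(1) injl(1)] sets by simp
  have "bij_betw v {m+1..m+n} {m+1..m+n} = bij_betw (f {m+1..m+n}) {m+1..m+n} {m+1..m+n}"
    by (rule bij_betw_cong) (auto simp: v_def)
  then have b2: "bij_betw v {m+1..m+n} {m+1..m+n}"
    using bij[OF inj(2) injl(2)] sets by simp
  have un: "{1..m} \<union> {m+1..m+n} = {1..m+n}" by auto
  have "bij_betw v ({1..m} \<union> {m+1..m+n}) ({1..m} \<union> {m+1..m+n})"
    by (rule bij_betw_combine[OF b1 b2]) auto
  then have v: "v permutes {1..m+n}"
    unfolding un by (rule bij_imp_permutes) (auto simp: v_def)
  have "inv v ` {1..m} = {1..m}"
    using b1 permutes_inj[OF v] by (metis bij_betw_imp_surj_on image_inv_f_f)
  then have "inv v \<in> weyl_group m n" using permutes_inv[OF v] by (simp add: weyl_group_def)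
  moreover have "lam i = dot_action m n (inv v) \<nu> i" for i
  proof -
    have "rho_shift m n \<nu> (v i) = rho_shift m n lam i"
    proof (cases "i \<in> {1..m+n}")
      case True
      then show ?thesis using f sets by (auto simp: v_def)
    next
      case False
      then show ?thesis using assms(1,2) by (auto simp: v_def rho_shift_def integral_weights_def)
    qed
    then show ?thesis by (simp add: dot_action_def permutes_inv_inv[OF v] rho_shift_def)
  qed
  ultimately show "\<exists>w \<in> weyl_group m n. lam = dot_action m n w \<nu>" by blast
qed

section \<open>Atypical roots and heights of a dominant weight\<close>

locale dominant_weight =
  fixes m n :: nat and lam :: "nat \<Rightarrow> int"
  assumes dominant: "lam \<in> dominant_weights m n"
begin

abbreviation "lr \<equiv> rho_shift m n lam"
abbreviation "r \<equiv> atypicality m n lam"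
abbreviation "row \<equiv> atyp_row m n lam"
abbreviation "col \<equiv> atyp_col m n lam"
abbreviation "aty \<equiv> atypical_tuple m n lam"
abbreviation "T \<equiv> typical_entries m n lam"

lemma integral: "lam \<in> integral_weights m n"
  using dominant by (simp add: dominant_weights_def)

lemma left_less: "i \<in> {1..m} \<Longrightarrow> j \<in> {1..m} \<Longrightarrow> i < j \<Longrightarrow> lr j < lr i"
proof -
  assume A: "i \<in> {1..m}" "j \<in> {1..m}" "i < j"
  then have "lam j \<le> lam i" using dominant unfolding dominant_weights_def monotone_on_def by auto
  then show ?thesis using A by (simp add: rho_shift_def rho_def)
qed

lemma right_less: "i \<in> {m+1..m+n} \<Longrightarrow> j \<in> {m+1..m+n} \<Longrightarrow> i < j \<Longrightarrow> lr i < lr j"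
proof -
  assume A: "i \<in> {m+1..m+n}" "j \<in> {m+1..m+n}" "i < j"
  then have "lam i \<le> lam j" using dominant unfolding dominant_weights_def monotone_on_def by auto
  then show ?thesis using A by (simp add: rho_shift_def rho_def)
qed

lemma left_less_iff: "i \<in> {1..m} \<Longrightarrow> j \<in> {1..m} \<Longrightarrow> lr j < lr i \<longleftrightarrow> i < j"
  using left_less by (metis linorder_neqE_nat order_less_asym order_less_irrefl)

lemma right_less_iff: "i \<in> {m+1..m+n} \<Longrightarrow> j \<in> {m+1..m+n} \<Longrightarrow> lr i < lr j \<longleftrightarrow> i < j"
  using right_less by (metis linorder_neqE_nat order_less_asym order_less_irrefl)

lemma inj_left: "inj_on lr {1..m}"
  by (rule linorder_inj_onI') (use left_less in force)

lemma inj_right: "inj_on lr {m+1..m+n}"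
  by (rule linorder_inj_onI') (use right_less in force)

lemma inj_on_snd_roots: "inj_on snd (atyp_roots m n lam)"
proof (rule inj_onI)
  fix x y assume A: "x \<in> atyp_roots m n lam" "y \<in> atyp_roots m n lam" "snd x = snd y"
  then have "lr (fst x) = lr (fst y)" "fst x \<in> {1..m}" "fst y \<in> {1..m}"
    by (auto simp: atyp_roots_def)
  then have "fst x = fst y" by (rule inj_onD[OF inj_left])
  then show "x = y" using A(3) by (simp add: prod_eq_iff)
qed

text \<open>Rows and columns are sorted separately in the definitions, so it must be shown that
  equal indices belong to one root. The map from the column of a root to its row is strictly
  decreasing, because shifted entries decrease on the left and increase on the right.\<close>

lemma root_at:
  assumes "s \<in> {1..r}"
  shows "(row s, col s) \<in> atyp_roots m n lam"
proof -
  let ?X = "atyp_roots m n lam"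
  let ?cs = "sorted_list_of_set (snd ` ?X)"
  define g where "g \<zeta> = fst (inv_into ?X snd \<zeta>)" for \<zeta>
  have g: "(g \<zeta>, \<zeta>) \<in> ?X" if "\<zeta> \<in> snd ` ?X" for \<zeta>
    using inv_into_into[OF that] f_inv_into_f[OF that] by (metis g_def prod.collapse)
  have g_img: "g ` snd ` ?X = fst ` ?X"
  proof -
    have "g (snd x) = fst x" if "x \<in> ?X" for x
      using that inj_on_snd_roots by (simp add: g_def)
    then show ?thesis unfolding image_image by (rule image_cong[OF refl])
  qed
  have fin: "finite (snd ` ?X)" using finite_atyp_roots by blast
  have len: "length ?cs = r"
    using card_image[OF inj_on_snd_roots] by (simp add: atypicality_def)
  have g_less: "g j < g i" if "i \<in> snd ` ?X" "j \<in> snd ` ?X" "i < j" for i j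
  proof -
    have A: "g i \<in> {1..m}" "g j \<in> {1..m}" "lr (g i) = lr (m + i)" "lr (g j) = lr (m + j)"
      "m + i \<in> {m+1..m+n}" "m + j \<in> {m+1..m+n}"
      using g[OF that(1)] g[OF that(2)] by (auto simp: atyp_roots_def)
    then show ?thesis using left_less_iff[of "g j" "g i"] right_less[of "m + i" "m + j"] that(3) by simp
  qed
  have "sorted_wrt (<) ?cs" by simp
  then have "sorted_wrt (\<lambda>i j. g j < g i) ?cs"
    by (rule sorted_wrt_mono_rel[rotated]) (use g_less fin in auto)
  then have "sorted_wrt (<) (rev (map g ?cs))"
    by (simp add: sorted_wrt_rev sorted_wrt_map)
  then have "sorted_list_of_set (set (rev (map g ?cs))) = rev (map g ?cs)"
    by (intro sorted_list_of_set.idem_if_sorted_distinct)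
      (auto simp only: strict_sorted_iff)
  then have "rev (sorted_list_of_set (fst ` ?X)) = map g ?cs"
    using fin g_img by (metis rev_rev_ident set_map set_rev set_sorted_list_of_set)
  then have "row s = g (col s)"
    using len assms nth_map[of "s - 1" ?cs g] by (auto simp: atyp_row_def atyp_col_def)
  moreover have "?cs ! (s - 1) \<in> set ?cs" using len assms by (intro nth_mem) auto
  then have "col s \<in> snd ` ?X" using fin by (simp add: atyp_col_def)
  ultimately show ?thesis using g by metis
qed

lemma root_bounds:
  assumes "s \<in> {1..r}"
  shows "row s \<in> {1..m}" "col s \<in> {1..n}" "lr (row s) = aty s" "lr (m + col s) = aty s"
  using root_at[OF assms] by (auto simp: atyp_roots_def atypical_tuple_def)

lemma col_less:
  assumes "s \<in> {1..r}" "t \<in> {1..r}" "s < t"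
  shows "col s < col t"
proof -
  have "length (sorted_list_of_set (snd ` atyp_roots m n lam)) = r"
    using card_image[OF inj_on_snd_roots] by (simp add: atypicality_def)
  then show ?thesis unfolding atyp_col_def
    using assms by (intro sorted_wrt_nth_less[of "(<)"]) auto
qed

lemma aty_less: "s \<in> {1..r} \<Longrightarrow> t \<in> {1..r} \<Longrightarrow> s < t \<Longrightarrow> aty s < aty t"
  using right_less[of "m + col s" "m + col t"] col_less root_bounds[of s] root_bounds[of t] by simp

lemma aty_less_iff: "s \<in> {1..r} \<Longrightarrow> t \<in> {1..r} \<Longrightarrow> aty s < aty t \<longleftrightarrow> s < t"
  using aty_less by (metis linorder_neqE_nat order_less_asym order_less_irrefl)

lemma aty_le_iff: "s \<in> {1..r} \<Longrightarrow> t \<in> {1..r} \<Longrightarrow> aty s \<le> aty t \<longleftrightarrow> s \<le> t"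
  using aty_less_iff by (meson not_less)

lemma inj_aty: "inj_on aty {1..r}"
  by (rule linorder_inj_onI') (use aty_less in force)

lemma inj_row: "inj_on row {1..r}"
proof (rule inj_onI)
  fix s t assume A: "s \<in> {1..r}" "t \<in> {1..r}" "row s = row t"
  then have "aty s = aty t" using root_bounds(3)[of s] root_bounds(3)[of t] by simp
  then show "s = t" using A(1,2) by (rule inj_onD[OF inj_aty])
qed

lemma roots_eq: "(\<lambda>s. (row s, col s)) ` {1..r} = atyp_roots m n lam"
proof (rule card_subset_eq)
  have "inj_on (\<lambda>s. (row s, col s)) {1..r}"
    by (rule inj_onI) (auto dest: inj_onD[OF inj_row])
  then show "card ((\<lambda>s. (row s, col s)) ` {1..r}) = card (atyp_roots m n lam)"
    by (simp add: card_image atypicality_def)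
qed (use root_at finite_atyp_roots in auto)

lemma row_image: "row ` {1..r} = {i \<in> {1..m}. lr i \<in> right_entries m n lam}"
  unfolding fst_atyp_roots[symmetric] roots_eq[symmetric] by (simp add: image_image)

lemma col_image: "col ` {1..r} = {\<zeta> \<in> {1..n}. lr (m + \<zeta>) \<in> left_entries m n lam}"
  unfolding snd_atyp_roots[symmetric] roots_eq[symmetric] by (simp add: image_image)

lemma aty_image: "aty ` {1..r} = left_entries m n lam \<inter> right_entries m n lam"
proof -
  have "aty ` {1..r} = lr ` (row ` {1..r})" using root_bounds(3) by (simp add: image_image)
  moreover have "f ` {i \<in> A. f i \<in> B} = f ` A \<inter> B" for f :: "nat \<Rightarrow> int" and A B by blast
  ultimately show ?thesis unfolding row_image by (simp only:)
qed

lemma aty_notin_T: "s \<in> {1..r} \<Longrightarrow> aty s \<notin> T"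
  using imageI[of s "{1..r}" aty] unfolding aty_image typical_entries_def by blast

text \<open>Count the entries below \<open>aty s\<close>: there are \<open>m - row s\<close> on the
  left and \<open>col s - 1\<close> on the right, and \<open>s - 1\<close> atypical values occur on
  both sides. The remaining ones are the typical entries that \<open>compress\<close>
  subtracts.\<close>

lemma height_eq:
  assumes s: "s \<in> {1..r}"
  shows "height m n lam s = compress T (aty s) - int s"
proof -
  let ?L = "left_entries m n lam" and ?R = "right_entries m n lam"
  let ?lt = "\<lambda>A. {z \<in> A. z < aty s}"
  note b = root_bounds[OF s]
  have "?lt ?L = lr ` {row s + 1..m}"
  proof -
    have "z \<in> ?lt ?L \<longleftrightarrow> z \<in> lr ` {row s + 1..m}" for z
    proof -
      have "z \<in> ?lt ?L \<longleftrightarrow> (\<exists>i \<in> {1..m}. z = lr i \<and> lr i < lr (row s))" using b by auto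
      also have "\<dots> \<longleftrightarrow> (\<exists>i \<in> {1..m}. z = lr i \<and> row s < i)"
        using left_less_iff[OF b(1)] by auto
      also have "\<dots> \<longleftrightarrow> z \<in> lr ` {i \<in> {1..m}. row s < i}" by blast
      also have "{i \<in> {1..m}. row s < i} = {row s + 1..m}" using b(1) by auto
      finally show ?thesis .
    qed
    then show ?thesis by blast
  qed
  then have cl: "card (?lt ?L) = m - row s"
    using inj_on_subset[OF inj_left, of "{row s + 1..m}"] by (simp add: card_image)
  have "?lt ?R = lr ` {m+1..<m + col s}"
  proof -
    have "z \<in> ?lt ?R \<longleftrightarrow> z \<in> lr ` {m+1..<m + col s}" for z
    proof -
      have "z \<in> ?lt ?R \<longleftrightarrow> (\<exists>i \<in> {m+1..m+n}. z = lr i \<and> lr i < lr (m + col s))" using b by auto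
      also have "\<dots> \<longleftrightarrow> (\<exists>i \<in> {m+1..m+n}. z = lr i \<and> i < m + col s)"
        using right_less_iff[of _ "m + col s"] b(2) by auto
      also have "\<dots> \<longleftrightarrow> z \<in> lr ` {i \<in> {m+1..m+n}. i < m + col s}" by blast
      also have "{i \<in> {m+1..m+n}. i < m + col s} = {m+1..<m + col s}" using b(2) by auto
      finally show ?thesis .
    qed
    then show ?thesis by blast
  qed
  then have cr: "card (?lt ?R) = col s - 1"
  proof -
    have "{m+1..<m + col s} \<subseteq> {m+1..m+n}" using b(2) by auto
    then show ?thesis
      using \<open>?lt ?R = _\<close> inj_on_subset[OF inj_right] by (simp add: card_image)
  qed
  have "?lt (?L \<inter> ?R) = aty ` {1..<s}"
    unfolding aty_image[symmetric] using s aty_less_iff[of _ s] by auto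
  then have ca: "card (?lt (?L \<inter> ?R)) = s - 1"
  proof -
    have "{1..<s} \<subseteq> {1..r}" using s by auto
    then show ?thesis
      using \<open>?lt (?L \<inter> ?R) = _\<close> inj_on_subset[OF inj_aty] by (simp add: card_image)
  qed
  \<comment> \<open>Inclusion-exclusion, where the union splits into typical and atypical
    values.\<close>
  have "card (?lt ?L) + card (?lt ?R) = card (?lt ?L \<union> ?lt ?R) + card (?lt ?L \<inter> ?lt ?R)"
    by (rule card_Un_Int) auto
  also have "?lt ?L \<inter> ?lt ?R = ?lt (?L \<inter> ?R)" by auto
  also have "?lt ?L \<union> ?lt ?R = ?lt T \<union> ?lt (?L \<inter> ?R)" by (auto simp: typical_entries_def)
  also have "card \<dots> = card (?lt T) + card (?lt (?L \<inter> ?R))"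
    by (rule card_Un_disjoint) (auto simp: typical_entries_def)
  finally have "m - row s + (col s - 1) = card (?lt T) + 2 * (s - 1)"
    unfolding cl cr ca by simp
  moreover have "lam (row s) = aty s - (int m + 1 - int (row s))"
    using b by (simp add: rho_shift_def rho_def)
  ultimately show ?thesis
    using b s unfolding height_def compress_def atLeastAtMost_iff by linarith
qed

lemma sorted_left: "sorted_wrt (\<lambda>i j. lr j < lr i) [1..<m+1]"
  by (rule sorted_wrt_mono_rel[OF _ sorted_wrt_upt], rule left_less) (auto simp del: upt_Suc)

lemma sorted_right: "sorted_wrt (\<lambda>i j. lr i < lr j) [m+1..<m+n+1]"
  by (rule sorted_wrt_mono_rel[OF _ sorted_wrt_upt], rule right_less) (auto simp del: upt_Suc)

lemma typical_lists:
  "sorted_wrt (>) (fst (typical_tuple m n lam))" "sorted_wrt (<) (snd (typical_tuple m n lam))"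
proof -
  show "sorted_wrt (>) (fst (typical_tuple m n lam))"
    unfolding typical_tuple_def fst_conv sorted_wrt_map
    by (rule sorted_wrt_filter[OF sorted_left])
  have "sorted_wrt (<) (filter (\<lambda>i. i \<notin> snd ` atyp_roots m n lam) [1..<n+1])"
    by (intro sorted_wrt_filter sorted_wrt_upt)
  then show "sorted_wrt (<) (snd (typical_tuple m n lam))"
    unfolding typical_tuple_def snd_conv sorted_wrt_map
    by (rule sorted_wrt_mono_rel[rotated]) (rule right_less, auto simp del: upt_Suc)
qed

end

section \<open>Dominant weights and typical tuples determined by entry sets\<close>

lemma sorted_lists_eq:
  fixes xs ys :: "'a::linorder list"
  assumes "sorted_wrt (<) xs" "sorted_wrt (<) ys" "set xs = set ys"
  shows "xs = ys"
  using assms sorted_distinct_set_unique strict_sorted_iff by blast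

lemma dominant_eqI:
  assumes "lam \<in> dominant_weights m n" "\<mu> \<in> dominant_weights m n"
    "left_entries m n \<mu> = left_entries m n lam" "right_entries m n \<mu> = right_entries m n lam"
  shows "\<mu> = lam"
proof
  fix i
  interpret l: dominant_weight m n lam by standard (rule assms)
  interpret u: dominant_weight m n \<mu> by standard (rule assms)
  have "rev (map u.lr [1..<m+1]) = rev (map l.lr [1..<m+1])"
  proof (rule sorted_lists_eq)
    show "sorted_wrt (<) (rev (map u.lr [1..<m+1]))" "sorted_wrt (<) (rev (map l.lr [1..<m+1]))"
      unfolding sorted_wrt_rev sorted_wrt_map by (rule u.sorted_left l.sorted_left)+
  qed (use assms(3) in \<open>simp add: atLeastLessThanSuc_atLeastAtMost del: upt_Suc\<close>)
  then have 1: "u.lr i = l.lr i" if "i \<in> {1..m}" for i using that by (auto simp del: upt_Suc)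
  have "map u.lr [m+1..<m+n+1] = map l.lr [m+1..<m+n+1]"
  proof (rule sorted_lists_eq)
    show "sorted_wrt (<) (map u.lr [m+1..<m+n+1])" "sorted_wrt (<) (map l.lr [m+1..<m+n+1])"
      unfolding sorted_wrt_map by (rule u.sorted_right l.sorted_right)+
  qed (use assms(4) in \<open>simp add: atLeastLessThanSuc_atLeastAtMost del: upt_Suc\<close>)
  then have 2: "u.lr i = l.lr i" if "i \<in> {m+1..m+n}" for i using that by (auto simp del: upt_Suc)
  show "\<mu> i = lam i"
  proof (cases "i \<in> {1..m+n}")
    case True
    then have "i \<in> {1..m} \<or> i \<in> {m+1..m+n}" by auto
    then show ?thesis using 1[of i] 2[of i] by (auto simp: rho_shift_def)
  next
    case False
    then show ?thesis using l.integral u.integral by (simp add: integral_weights_def)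
  qed
qed

lemma dominant_rep_eq_iff:
  assumes lam: "lam \<in> dominant_weights m n" and nu: "\<nu> \<in> integral_weights m n"
    and inj: "inj_on (rho_shift m n \<nu>) {1..m}" "inj_on (rho_shift m n \<nu>) {m+1..m+n}"
  shows "dominant_rep m n \<nu> = lam \<longleftrightarrow>
    left_entries m n \<nu> = left_entries m n lam \<and> right_entries m n \<nu> = right_entries m n lam"
proof -
  have orbit: "(\<exists>w \<in> weyl_group m n. \<kappa> = dot_action m n w \<nu>) \<longleftrightarrow>
    left_entries m n \<nu> = left_entries m n \<kappa> \<and> right_entries m n \<nu> = right_entries m n \<kappa>"
    if "\<kappa> \<in> dominant_weights m n" for \<kappa>
  proof -
    interpret dominant_weight m n \<kappa> by standard (rule that)
    show ?thesis using dot_orbit_iff[OF integral nu inj inj_left inj_right] .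
  qed
  have rep: "dominant_rep m n \<nu> = \<kappa>"
    if "\<kappa> \<in> dominant_weights m n" "left_entries m n \<nu> = left_entries m n \<kappa>"
      "right_entries m n \<nu> = right_entries m n \<kappa>" for \<kappa>
    unfolding dominant_rep_def
  proof (rule the_equality)
    fix \<kappa>' assume "\<kappa>' \<in> dominant_weights m n \<and> (\<exists>w \<in> weyl_group m n. \<kappa>' = dot_action m n w \<nu>)"
    then show "\<kappa>' = \<kappa>" using orbit[of \<kappa>'] that by (intro dominant_eqI) auto
  qed (use orbit that in auto)
  \<comment> \<open>The forward direction needs the description to denote: it denotes the dominant
    weight \<kappa> with the entry sets of \<nu>, so equality with \<open>lam\<close> transfers
    these sets.\<close>
  obtain \<kappa> where \<kappa>: "\<kappa> \<in> dominant_weights m n" "left_entries m n \<kappa> = left_entries m n \<nu>"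
    "right_entries m n \<kappa> = right_entries m n \<nu>"
    using dominant_weight_exists[of "left_entries m n \<nu>" m "right_entries m n \<nu>" n]
      card_image[OF inj(1)] card_image[OF inj(2)] by auto
  show ?thesis using rep[of lam] rep[of \<kappa>] \<kappa> lam by auto
qed

lemma typical_tuple_eq_iff:
  assumes "lam \<in> dominant_weights m n" "\<mu> \<in> dominant_weights m n"
  shows "typical_tuple m n \<mu> = typical_tuple m n lam \<longleftrightarrow>
    left_entries m n \<mu> - right_entries m n \<mu> = left_entries m n lam - right_entries m n lam \<and>
    right_entries m n \<mu> - left_entries m n \<mu> = right_entries m n lam - left_entries m n lam"
    (is "_ \<longleftrightarrow> ?R")
proof
  assume "typical_tuple m n \<mu> = typical_tuple m n lam"
  then show ?R using set_typical_tuple by metis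
next
  assume ?R
  interpret l: dominant_weight m n lam by standard (rule assms)
  interpret u: dominant_weight m n \<mu> by standard (rule assms)
  have "rev (fst (typical_tuple m n \<mu>)) = rev (fst (typical_tuple m n lam))"
    by (rule sorted_lists_eq)
      (use \<open>?R\<close> set_typical_tuple l.typical_lists u.typical_lists in \<open>auto simp: sorted_wrt_rev\<close>)
  moreover have "snd (typical_tuple m n \<mu>) = snd (typical_tuple m n lam)"
    by (rule sorted_lists_eq) (use \<open>?R\<close> set_typical_tuple l.typical_lists u.typical_lists in auto)
  ultimately show "typical_tuple m n \<mu> = typical_tuple m n lam" by (simp add: prod_eq_iff)
qed

section \<open>Raising operators as particle jumps\<close>

lemma walk_diff:
  assumes "finite Q" "q \<le> z"
  shows "walk T Q z - walk T Q q = compress T z - compress T q - 2 * int (card {x \<in> Q. q \<le> x \<and> x < z})"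
proof -
  have "{x \<in> Q. x < z} = {x \<in> Q. x < q} \<union> {x \<in> Q. q \<le> x \<and> x < z}" using assms(2) by auto
  also have "card \<dots> = card {x \<in> Q. x < q} + card {x \<in> Q. q \<le> x \<and> x < z}"
    by (rule card_Un_disjoint) (use assms(1) in auto)
  finally show ?thesis by (simp add: walk_def)
qed

context dominant_weight
begin

lemma typical_entriesI:
  "z \<in> left_entries m n lam - right_entries m n lam \<Longrightarrow> z \<in> T"
  "z \<in> right_entries m n lam - left_entries m n lam \<Longrightarrow> z \<in> T"
  unfolding typical_entries_def by blast+

text \<open>Intermediate weights of a composition of raising operators are in general not dominant.
  They are therefore described relative to the dominant starting weight, called \<open>lam\<close>
  in this locale: the root positions stay put and \<open>p s\<close> is the current value of the
  \<open>s\<close>-th atypical pair. In the comparison of two weights, \<mu> takes the place of this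
  \<open>lam\<close>.\<close>

definition deformation :: "(nat \<Rightarrow> int) \<Rightarrow> (nat \<Rightarrow> int) \<Rightarrow> bool" where
  "deformation p \<nu> \<longleftrightarrow>
     (\<forall>s \<in> {1..r}. rho_shift m n \<nu> (row s) = p s \<and> rho_shift m n \<nu> (m + col s) = p s) \<and>
     (\<forall>i. i \<notin> row ` {1..r} \<longrightarrow> i \<notin> (\<lambda>s. m + col s) ` {1..r} \<longrightarrow> \<nu> i = lam i)"

lemma deformation_self: "deformation aty lam"
  using root_bounds(3,4) by (simp add: deformation_def)

section \<open>Weights with displaced atypical entries\<close>

context
  fixes p :: "nat \<Rightarrow> int" and \<nu> :: "nat \<Rightarrow> int"
  assumes deform: "deformation p \<nu>"
    and inj_p: "inj_on p {1..r}" and p_T: "\<And>s. s \<in> {1..r} \<Longrightarrow> p s \<notin> T"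
begin

lemma deformation_left_cases:
  assumes "i \<in> {1..m}"
  obtains (atypical) s where "s \<in> {1..r}" "i = row s" "rho_shift m n \<nu> i = p s" "lr i = aty s"
  | (typical) "rho_shift m n \<nu> i = lr i" "lr i \<in> left_entries m n lam - right_entries m n lam"
proof (cases "i \<in> row ` {1..r}")
  case True
  then obtain s where "s \<in> {1..r}" "i = row s" by blast
  then show thesis using atypical[of s] deform root_bounds(3)[of s] by (simp add: deformation_def)
next
  case False
  moreover have "i \<notin> (\<lambda>s. m + col s) ` {1..r}" using root_bounds(2) assms by force
  ultimately have "\<nu> i = lam i" using deform unfolding deformation_def by blast
  then have "rho_shift m n \<nu> i = lr i" by (simp add: rho_shift_def)
  moreover have "lr i \<notin> right_entries m n lam" using False assms unfolding row_image by blast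
  ultimately show thesis using typical assms by blast
qed

lemma deformation_right_cases:
  assumes "i \<in> {m+1..m+n}"
  obtains (atypical) s where "s \<in> {1..r}" "i = m + col s" "rho_shift m n \<nu> i = p s" "lr i = aty s"
  | (typical) "rho_shift m n \<nu> i = lr i" "lr i \<in> right_entries m n lam - left_entries m n lam"
proof (cases "i \<in> (\<lambda>s. m + col s) ` {1..r}")
  case True
  then obtain s where "s \<in> {1..r}" "i = m + col s" by blast
  then show thesis using atypical[of s] deform root_bounds(4)[of s] by (simp add: deformation_def)
next
  case False
  moreover have "i \<notin> row ` {1..r}" using root_bounds(1) assms by force
  ultimately have "\<nu> i = lam i" using deform unfolding deformation_def by blast
  then have "rho_shift m n \<nu> i = lr i" by (simp add: rho_shift_def)
  moreover have "lr i \<notin> left_entries m n lam"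
  proof
    assume "lr i \<in> left_entries m n lam"
    moreover have "i = m + (i - m)" "i - m \<in> {1..n}" using assms by auto
    ultimately have "i - m \<in> col ` {1..r}" unfolding col_image by simp
    then obtain t where "t \<in> {1..r}" "i - m = col t" by blast
    then have "i \<in> (\<lambda>s. m + col s) ` {1..r}"
      using \<open>i = m + (i - m)\<close> by (intro image_eqI[of _ _ t]) auto
    then show False using False by contradiction
  qed
  ultimately show thesis using typical assms by blast
qed

lemma deformation_inj:
  "inj_on (rho_shift m n \<nu>) {1..m}" "inj_on (rho_shift m n \<nu>) {m+1..m+n}"
proof -
  show "inj_on (rho_shift m n \<nu>) {1..m}"
  proof (rule inj_onI)
    fix i j assume i: "i \<in> {1..m}" and j: "j \<in> {1..m}" and eq: "rho_shift m n \<nu> i = rho_shift m n \<nu> j"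
    show "i = j"
    proof (cases rule: deformation_left_cases[OF i]; cases rule: deformation_left_cases[OF j])
      fix s t assume A: "s \<in> {1..r}" "i = row s" "rho_shift m n \<nu> i = p s"
        "t \<in> {1..r}" "j = row t" "rho_shift m n \<nu> j = p t"
      then have "s = t" using inj_onD[OF inj_p, of s t] eq by simp
      then show ?thesis using A by simp
    next
      fix s assume "s \<in> {1..r}" "rho_shift m n \<nu> i = p s"
        "rho_shift m n \<nu> j = lr j" "lr j \<in> left_entries m n lam - right_entries m n lam"
      then show ?thesis using eq p_T[of s] typical_entriesI[of "lr j"] by metis
    next
      fix s assume "s \<in> {1..r}" "rho_shift m n \<nu> j = p s"
        "rho_shift m n \<nu> i = lr i" "lr i \<in> left_entries m n lam - right_entries m n lam"
      then show ?thesis using eq p_T[of s] typical_entriesI[of "lr i"] by metis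
    next
      assume "rho_shift m n \<nu> i = lr i" "rho_shift m n \<nu> j = lr j"
      then have "lr i = lr j" using eq by simp
      then show ?thesis using i j by (rule inj_onD[OF inj_left])
    qed
  qed
  show "inj_on (rho_shift m n \<nu>) {m+1..m+n}"
  proof (rule inj_onI)
    fix i j assume i: "i \<in> {m+1..m+n}" and j: "j \<in> {m+1..m+n}"
      and eq: "rho_shift m n \<nu> i = rho_shift m n \<nu> j"
    show "i = j"
    proof (cases rule: deformation_right_cases[OF i]; cases rule: deformation_right_cases[OF j])
      fix s t assume A: "s \<in> {1..r}" "i = m + col s" "rho_shift m n \<nu> i = p s"
        "t \<in> {1..r}" "j = m + col t" "rho_shift m n \<nu> j = p t"
      then have "s = t" using inj_onD[OF inj_p, of s t] eq by simp
      then show ?thesis using A by simp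
    next
      fix s assume "s \<in> {1..r}" "rho_shift m n \<nu> i = p s"
        "rho_shift m n \<nu> j = lr j" "lr j \<in> right_entries m n lam - left_entries m n lam"
      then show ?thesis using eq p_T[of s] typical_entriesI[of "lr j"] by metis
    next
      fix s assume "s \<in> {1..r}" "rho_shift m n \<nu> j = p s"
        "rho_shift m n \<nu> i = lr i" "lr i \<in> right_entries m n lam - left_entries m n lam"
      then show ?thesis using eq p_T[of s] typical_entriesI[of "lr i"] by metis
    next
      assume "rho_shift m n \<nu> i = lr i" "rho_shift m n \<nu> j = lr j"
      then have "lr i = lr j" using eq by simp
      then show ?thesis using i j by (rule inj_onD[OF inj_right])
    qed
  qed
qed

lemma deformation_left_entries:
  "left_entries m n \<nu> = p ` {1..r} \<union> (left_entries m n lam - right_entries m n lam)"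
proof (intro equalityI subsetI)
  fix z assume "z \<in> left_entries m n \<nu>"
  then obtain i where i: "i \<in> {1..m}" "z = rho_shift m n \<nu> i" by blast
  show "z \<in> p ` {1..r} \<union> (left_entries m n lam - right_entries m n lam)"
    by (cases rule: deformation_left_cases[OF i(1)]) (simp_all add: i(2))
next
  fix z assume "z \<in> p ` {1..r} \<union> (left_entries m n lam - right_entries m n lam)"
  then consider s where "s \<in> {1..r}" "z = p s"
    | i where "i \<in> {1..m}" "z = lr i" "lr i \<notin> right_entries m n lam" by blast
  then show "z \<in> left_entries m n \<nu>"
  proof cases
    case 1
    then have "z = rho_shift m n \<nu> (row s)" using deform by (simp add: deformation_def)
    then show ?thesis using root_bounds(1)[OF 1(1)] by blast
  next
    case 2
    have "z = rho_shift m n \<nu> i"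
    proof (cases rule: deformation_left_cases[OF 2(1)])
      case (1 s)
      have "aty s \<in> aty ` {1..r}" using 1(1) by blast
      then show ?thesis using 1 2 unfolding aty_image by auto
    next
      case 2
      then show ?thesis using \<open>z = lr i\<close> by simp
    qed
    then show ?thesis using 2(1) by blast
  qed
qed

lemma deformation_right_entries:
  "right_entries m n \<nu> = p ` {1..r} \<union> (right_entries m n lam - left_entries m n lam)"
proof (intro equalityI subsetI)
  fix z assume "z \<in> right_entries m n \<nu>"
  then obtain i where i: "i \<in> {m+1..m+n}" "z = rho_shift m n \<nu> i" by blast
  show "z \<in> p ` {1..r} \<union> (right_entries m n lam - left_entries m n lam)"
    by (cases rule: deformation_right_cases[OF i(1)]) (simp_all add: i(2))
next
  fix z assume "z \<in> p ` {1..r} \<union> (right_entries m n lam - left_entries m n lam)"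
  then consider s where "s \<in> {1..r}" "z = p s"
    | i where "i \<in> {m+1..m+n}" "z = lr i" "lr i \<notin> left_entries m n lam" by blast
  then show "z \<in> right_entries m n \<nu>"
  proof cases
    case 1
    then have "z = rho_shift m n \<nu> (m + col s)" using deform by (simp add: deformation_def)
    moreover have "m + col s \<in> {m+1..m+n}" using root_bounds(2)[OF 1(1)] by simp
    ultimately show ?thesis by blast
  next
    case 2
    have "z = rho_shift m n \<nu> i"
    proof (cases rule: deformation_right_cases[OF 2(1)])
      case (1 s)
      have "aty s \<in> aty ` {1..r}" using 1(1) by blast
      then show ?thesis using 1 2 unfolding aty_image by auto
    next
      case 2
      then show ?thesis using \<open>z = lr i\<close> by simp
    qed
    then show ?thesis using 2(1) by blast
  qed
qed

text \<open>The values \<open>p s\<close> are distinct and avoid the typical entries, so no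
  coincidence between the two sides is created or lost. Hence the indices of the roots keep their
  meaning throughout the composition.\<close>

lemma deformation_roots: "atyp_roots m n \<nu> = atyp_roots m n lam"
proof -
  have "rho_shift m n \<nu> i = rho_shift m n \<nu> (m + \<zeta>) \<longleftrightarrow> lr i = lr (m + \<zeta>)"
    if i: "i \<in> {1..m}" and z: "\<zeta> \<in> {1..n}" for i \<zeta>
  proof -
    have z': "m + \<zeta> \<in> {m+1..m+n}" using z by simp
    show ?thesis
    proof (cases rule: deformation_left_cases[OF i]; cases rule: deformation_right_cases[OF z'])
      fix s t assume "s \<in> {1..r}" "rho_shift m n \<nu> i = p s" "lr i = aty s"
        "t \<in> {1..r}" "rho_shift m n \<nu> (m + \<zeta>) = p t" "lr (m + \<zeta>) = aty t"
      then show ?thesis using inj_on_eq_iff[OF inj_p, of s t] inj_on_eq_iff[OF inj_aty, of s t] by simp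
    next
      fix s assume A: "s \<in> {1..r}" "rho_shift m n \<nu> i = p s" "lr i = aty s"
        "rho_shift m n \<nu> (m + \<zeta>) = lr (m + \<zeta>)"
        "lr (m + \<zeta>) \<in> right_entries m n lam - left_entries m n lam"
      then have "lr (m + \<zeta>) \<in> T" by (intro typical_entriesI)
      then show ?thesis using A p_T[of s] aty_notin_T[of s] by metis
    next
      fix s assume A: "s \<in> {1..r}" "rho_shift m n \<nu> (m + \<zeta>) = p s" "lr (m + \<zeta>) = aty s"
        "rho_shift m n \<nu> i = lr i" "lr i \<in> left_entries m n lam - right_entries m n lam"
      then have "lr i \<in> T" by (intro typical_entriesI)
      then show ?thesis using A p_T[of s] aty_notin_T[of s] by metis
    qed simp
  qed
  then show ?thesis by (auto simp: atyp_roots_def)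
qed

lemma deformation_atyp:
  "atypicality m n \<nu> = r" "atyp_row m n \<nu> = row" "atyp_col m n \<nu> = col"
  by (simp_all add: atypicality_def deformation_roots atyp_row_def[abs_def] atyp_col_def[abs_def])

lemma deformation_aty: "s \<in> {1..r} \<Longrightarrow> atypical_tuple m n \<nu> s = p s"
  using deform by (simp add: atypical_tuple_def deformation_atyp deformation_def)

lemma deformation_integral: "\<nu> \<in> integral_weights m n"
proof -
  have "\<nu> i = 0" if "i \<notin> {1..m+n}" for i
  proof -
    have "i \<notin> row ` {1..r}" using root_bounds(1) that by force
    moreover have "i \<notin> (\<lambda>s. m + col s) ` {1..r}" using root_bounds(2) that by force
    ultimately have "\<nu> i = lam i" using deform unfolding deformation_def by blast
    then show ?thesis using integral that by (simp add: integral_weights_def)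
  qed
  then show ?thesis by (simp add: integral_weights_def)
qed

lemma deformation_k_num:
  assumes s: "s \<in> {1..r}"
  shows "p s + k_num m n \<nu> s = next_free T (p ` {t \<in> {1..r}. p s < p t}) (p s)"
proof -
  let ?a = "atypical_tuple m n \<nu>"
  let ?ts = "rev (sort_key ?a [1..<r + 1])"
  let ?S = "rho_shift m n \<nu> ` {1..m+n}"
  have set_ts: "set ?ts = {1..r}" by auto
  have img: "?a ` {1..r} = p ` {1..r}" using deformation_aty by (rule image_cong[OF refl])
  have "?a s + k_search ?a ?S ?ts s = next_free T ({} \<union> ?a ` {t \<in> set ?ts. ?a s < ?a t}) (?a s)"
  proof (rule k_search_eq_next_free)
    \<comment> \<open>Sorting yields a weak order; distinctness of the indices and injectivity of
      \<open>p\<close> make it strict, as the search lemma requires.\<close>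
    have "sorted_wrt (\<lambda>s t. ?a s \<le> ?a t) (sort_key ?a [1..<r + 1])"
      using sorted_sort_key[of ?a "[1..<r + 1]"] unfolding sorted_map .
    moreover have "distinct (sort_key ?a [1..<r + 1])" by (simp del: upt_Suc)
    ultimately have "sorted_wrt (\<lambda>s t. ?a s \<le> ?a t \<and> s \<noteq> t) (sort_key ?a [1..<r + 1])"
      by (auto simp: sorted_wrt_iff_nth_less nth_eq_iff_index_eq simp del: upt_Suc)
    then have "sorted_wrt (\<lambda>s t. ?a s < ?a t) (sort_key ?a [1..<r + 1])"
    proof (rule sorted_wrt_mono_rel[rotated])
      fix x y assume xy: "x \<in> set (sort_key ?a [1..<r + 1])" "y \<in> set (sort_key ?a [1..<r + 1])"
        "?a x \<le> ?a y \<and> x \<noteq> y"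
      then have "x \<in> {1..r}" "y \<in> {1..r}" by (auto simp del: upt_Suc)
      then show "?a x < ?a y" using xy(3) inj_onD[OF inj_p, of x y] deformation_aty by fastforce
    qed
    then show "sorted_wrt (\<lambda>s t. ?a t < ?a s) ?ts" by (simp add: sorted_wrt_rev)
    show "\<forall>t\<in>set ?ts. ?a t \<notin> T" unfolding set_ts using p_T deformation_aty by simp
    have "{1..m+n} = {1..m} \<union> {m+1..m+n}" by auto
    then have "?S = left_entries m n \<nu> \<union> right_entries m n \<nu>" by (simp only: image_Un)
    also have "\<dots> = T \<union> p ` {1..r}"
      unfolding deformation_left_entries deformation_right_entries typical_entries_def by blast
    \<comment> \<open>Before any particle is processed, the free positions are the complement of the
      typical entries, so the invariant of the search starts with \<open>Q\<close> empty.\<close>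
    finally show "?S = - free T {} \<union> ?a ` set ?ts"
      unfolding set_ts img free_empty[OF finite_typical_entries] by simp
  qed (use s set_ts in \<open>simp_all add: finite_typical_entries del: upt_Suc\<close>)
  moreover have "?a ` {t \<in> set ?ts. ?a s < ?a t} = p ` {t \<in> {1..r}. p s < p t}"
    unfolding set_ts using deformation_aty s by (intro image_cong) auto
  ultimately show ?thesis
    using deformation_aty[OF s] deformation_atyp by (simp add: k_num_def)
qed

lemma deformation_raise_op:
  assumes s: "s \<in> {1..r}"
  shows "deformation (p(s := next_free T (p ` {t \<in> {1..r}. p s < p t}) (p s))) (raise_op m n s \<nu>)"
proof -
  let ?x = "next_free T (p ` {t \<in> {1..r}. p s < p t}) (p s)"
  have raise: "raise_op m n s \<nu> i =
      (if i = row s \<or> i = m + col s then \<nu> i + k_num m n \<nu> s else \<nu> i)" for i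
    by (simp add: raise_op_def deformation_atyp)
  have ne: "row t \<noteq> row s" "col t \<noteq> col s" if "t \<in> {1..r}" "t \<noteq> s" for t
  proof -
    show "row t \<noteq> row s" using that s inj_onD[OF inj_row, of t s] by blast
    show "col t \<noteq> col s" using that s col_less[of s t] col_less[of t s] by (auto simp: neq_iff)
  qed
  have ne': "row t \<noteq> m + col u" if "t \<in> {1..r}" "u \<in> {1..r}" for t u
    using root_bounds(1)[OF that(1)] root_bounds(2)[OF that(2)] by auto
  have nu: "rho_shift m n \<nu> (row t) = p t" "rho_shift m n \<nu> (m + col t) = p t"
    if "t \<in> {1..r}" for t
    using deform that by (simp_all add: deformation_def)
  show ?thesis unfolding deformation_def
  proof (intro conjI ballI allI impI)
    fix t assume t: "t \<in> {1..r}"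
    show "rho_shift m n (raise_op m n s \<nu>) (row t) = (p(s := ?x)) t"
      using nu[OF t] ne[OF t] ne'[OF t s] deformation_k_num[OF s]
      by (cases "t = s") (auto simp: rho_shift_def raise)
    show "rho_shift m n (raise_op m n s \<nu>) (m + col t) = (p(s := ?x)) t"
      using nu[OF t] ne[OF t] ne'[OF s t] deformation_k_num[OF s]
      by (cases "t = s") (auto simp: rho_shift_def raise)
  next
    fix i assume i: "i \<notin> row ` {1..r}" "i \<notin> (\<lambda>s. m + col s) ` {1..r}"
    then have "raise_op m n s \<nu> i = \<nu> i" using s by (auto simp: raise)
    then show "raise_op m n s \<nu> i = lam i" using deform i by (simp add: deformation_def)
  qed
qed

text \<open>Each entry set of \<nu> is the disjoint union of the particle positions and an unchanged
  typical part, so equality of entry sets splits into equality of typical parts and of atypical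
  values.\<close>

lemma deformation_dominant_rep:
  assumes "lam' \<in> dominant_weights m n"
  shows "dominant_rep m n \<nu> = lam' \<longleftrightarrow> typical_tuple m n lam = typical_tuple m n lam' \<and>
    p ` {1..r} = left_entries m n lam' \<inter> right_entries m n lam'"
proof -
  have "p ` {1..r} \<inter> T = {}" using p_T by blast
  then have eq: "p ` {1..r} \<union> (L - R) = L' \<and> p ` {1..r} \<union> (R - L) = R' \<longleftrightarrow>
      (L - R = L' - R' \<and> R - L = R' - L') \<and> p ` {1..r} = L' \<inter> R'"
    if "T = (L - R) \<union> (R - L)" for L R L' R'
    using that by blast
  show ?thesis
    unfolding dominant_rep_eq_iff[OF assms deformation_integral deformation_inj]
      deformation_left_entries deformation_right_entries typical_tuple_eq_iff[OF assms dominant]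
    by (rule eq[OF typical_entries_def])
qed

end

text \<open>Only the particles of higher index matter for freeness, since their operators act
  first.\<close>

definition admissible :: "(nat \<Rightarrow> int) \<Rightarrow> bool" where
  "admissible p \<longleftrightarrow> (\<forall>s \<in> {1..r}. aty s \<le> p s \<and> p s \<in> free T (p ` {s<..r}))"

lemma admissibleD:
  assumes "admissible p" "s \<in> {1..r}"
  shows "aty s \<le> p s" "p s \<in> free T (p ` {s<..r})" "p s \<notin> T" "p s \<notin> p ` {s<..r}"
  using assms by (auto simp: admissible_def free_def)

lemma admissible_inj:
  assumes "admissible p"
  shows "inj_on p {1..r}"
proof (rule linorder_inj_onI')
  fix s t assume "s \<in> {1..r}" "t \<in> {1..r}" "s < t"
  then show "p s \<noteq> p t" using admissibleD(4)[OF assms, of s] by auto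
qed

lemma admissible_disjoint: "admissible p \<Longrightarrow> s \<in> {1..r} \<Longrightarrow> T \<inter> p ` {s<..r} = {}"
  using admissibleD(3)[of p] by fastforce

lemma admissible_below:
  assumes "\<And>t. t \<in> {1..r} \<Longrightarrow> aty t \<le> p t" "s \<in> {1..r}" "q \<in> p ` {s<..r}"
  shows "aty s < q"
proof -
  obtain t where t: "t \<in> {s<..r}" "q = p t" using assms(3) by blast
  then have "t \<in> {1..r}" "s < t" using assms(2) by auto
  then show ?thesis using aty_less[OF assms(2), of t] assms(1)[of t] t(2) by linarith
qed

text \<open>A particle at its starting point lies left of all particles of higher index, wherever
  these have moved, so its freeness is automatic.\<close>

lemma aty_free:
  assumes "\<And>t. t \<in> {1..r} \<Longrightarrow> aty t \<le> p t" "s \<in> {1..r}"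
  shows "aty s \<in> free T (p ` {s<..r})"
  using below_free[OF finite_typical_entries] admissible_below[OF assms(1) assms(2)]
    aty_notin_T[OF assms(2)] by blast

lemma admissible_aty: "admissible aty"
  using aty_free[of aty] by (simp add: admissible_def)

lemma walk_aty:
  assumes "admissible p" "s \<in> {1..r}"
  shows "walk T (p ` {s<..r}) (aty s) = compress T (aty s)"
proof (rule walk_below)
  show "\<forall>q \<in> p ` {s<..r}. aty s \<le> q"
    using admissible_below[OF admissibleD(1)[OF assms(1)] assms(2)] by (simp add: less_imp_le)
qed

text \<open>One jump of particle \<open>s\<close> goes to the next position free for the particles
  of higher index. Those keep their conditions, particle \<open>s\<close> lands on a free position,
  and the lower ones are still at their starting points.\<close>

lemma admissible_raise:
  assumes adm: "admissible p" and p0: "\<And>t. t \<in> {1..<s} \<Longrightarrow> p t = aty t"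
    and s: "s \<in> {1..r}" and def: "deformation p \<nu>"
  obtains x where "admissible (p(s := x))" "deformation (p(s := x)) (raise_op m n s \<nu>)"
    "walk T (p ` {s<..r}) x = walk T (p ` {s<..r}) (p s) + 1"
proof
  let ?Q = "p ` {s<..r}"
  let ?x = "next_free T ?Q (p s)"
  have cof: "finite (- free T ?Q)"
    by (rule cofinite_free) (use finite_typical_entries admissible_disjoint[OF adm s] in auto)
  note nf = next_free_props[OF cof, of "p s"]
  show "walk T ?Q ?x = walk T ?Q (p s) + 1"
    by (rule walk_next_free)
      (use finite_typical_entries admissible_disjoint[OF adm s] cof admissibleD(2)[OF adm s] in auto)
  \<comment> \<open>Particles of lower index have not moved and lie left of \<open>p s\<close>, so
    the search meets only those of higher index.\<close>
  have "p ` {t \<in> {1..r}. p s < p t} = {q \<in> ?Q. p s < q}"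
  proof -
    have "s < t" if "t \<in> {1..r}" "p s < p t" for t
    proof (rule ccontr)
      assume "\<not> s < t"
      then consider "t = s" | "t < s" by linarith
      then show False
      proof cases
        case 2
        then have "p t = aty t" using p0 that by simp
        then show False using that 2 aty_less[OF that(1) s 2] admissibleD(1)[OF adm s] by simp
      qed (use that in simp)
    qed
    then show ?thesis using s by auto
  qed
  then have x: "next_free T (p ` {t \<in> {1..r}. p s < p t}) (p s) = ?x"
    using next_free_upper_part[OF finite_typical_entries _ admissibleD(2)[OF adm s]] by simp
  show "deformation (p(s := ?x)) (raise_op m n s \<nu>)"
    using deformation_raise_op[OF def admissible_inj[OF adm] admissibleD(3)[OF adm] s] x by simp
  let ?p = "p(s := ?x)"
  have ge: "aty t \<le> ?p t" if "t \<in> {1..r}" for t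
    using admissibleD(1)[OF adm that] nf(1) by auto
  have "?p t \<in> free T (?p ` {t<..r})" if t: "t \<in> {1..r}" for t
  proof -
    consider "t < s" | "t = s" | "s < t" by linarith
    then show ?thesis
    proof cases
      case 1
      then have "?p t = aty t" using p0 t by simp
      then show ?thesis using aty_free[OF ge t] by simp
    next
      case 2
      then show ?thesis using nf(2) by (simp add: image_def)
    next
      case 3
      then have "?p ` {t<..r} = p ` {t<..r}" by (intro image_cong) auto
      then show ?thesis using admissibleD(2)[OF adm t] 3 by simp
    qed
  qed
  then show "admissible ?p" using ge by (simp add: admissible_def)
qed

text \<open>Each jump adds 1 to a walk that stays fixed while only particle \<open>s\<close> moves,
  so the number of jumps is read off from the final position.\<close>

lemma admissible_raise_pow:
  assumes adm: "admissible p" and p0: "\<And>t. t \<in> {1..s} \<Longrightarrow> p t = aty t"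
    and s: "s \<in> {1..r}" and def: "deformation p \<nu>"
  obtains x where "admissible (p(s := x))" "deformation (p(s := x)) ((raise_op m n s ^^ j) \<nu>)"
    "walk T (p ` {s<..r}) x = compress T (aty s) + int j"
proof -
  have "\<exists>x. admissible (p(s := x)) \<and> deformation (p(s := x)) ((raise_op m n s ^^ j) \<nu>) \<and>
    walk T (p ` {s<..r}) x = compress T (aty s) + int j"
  proof (induction j)
    case 0
    have "p(s := aty s) = p" using p0 s by auto
    then show ?case using adm def walk_aty[OF adm s] by (intro exI[of _ "aty s"]) simp
  next
    case (Suc j)
    then obtain x where x: "admissible (p(s := x))"
      "deformation (p(s := x)) ((raise_op m n s ^^ j) \<nu>)"
      "walk T (p ` {s<..r}) x = compress T (aty s) + int j" by blast
    have "(p(s := x)) t = aty t" if "t \<in> {1..<s}" for t using p0 that by auto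
    then obtain y where y: "admissible (p(s := x, s := y))"
      "deformation (p(s := x, s := y)) (raise_op m n s ((raise_op m n s ^^ j) \<nu>))"
      "walk T ((p(s := x)) ` {s<..r}) y = walk T ((p(s := x)) ` {s<..r}) ((p(s := x)) s) + 1"
      using admissible_raise[OF x(1) _ s x(2)] by blast
    have "(p(s := x)) ` {s<..r} = p ` {s<..r}" by (intro image_cong) auto
    then have "admissible (p(s := y))" "deformation (p(s := y)) ((raise_op m n s ^^ Suc j) \<nu>)"
      "walk T (p ` {s<..r}) y = compress T (aty s) + int (Suc j)"
      using x(3) y by simp_all
    then show ?case by blast
  qed
  then show ?thesis using that by blast
qed

lemma admissible_fold:
  assumes "1 \<le> s" "s \<le> r + 1"
  shows "\<exists>p. admissible p \<and> (\<forall>t \<in> {1..<s}. p t = aty t) \<and>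
    deformation p (foldr (\<lambda>s \<nu>. (raise_op m n s ^^ \<theta> s) \<nu>) [s..<r + 1] lam) \<and>
    (\<forall>t \<in> {s..r}. walk T (p ` {t<..r}) (p t) = compress T (aty t) + int (\<theta> t))"
  \<comment> \<open>The induction descends from \<open>r + 1\<close>, where no operator has acted,
    because \<open>foldr\<close> applies the operator of highest index first.\<close>
  using assms(2,1)
proof (induction s rule: inc_induct)
  case base
  then show ?case using admissible_aty deformation_self by (intro exI[of _ aty]) simp
next
  case (step s)
  let ?f = "\<lambda>s \<nu>. (raise_op m n s ^^ \<theta> s) \<nu>"
  obtain p where p: "admissible p" "\<And>t. t \<in> {1..<Suc s} \<Longrightarrow> p t = aty t"
    "deformation p (foldr ?f [Suc s..<r + 1] lam)"
    "\<And>t. t \<in> {Suc s..r} \<Longrightarrow> walk T (p ` {t<..r}) (p t) = compress T (aty t) + int (\<theta> t)"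
    using step by auto
  have s: "s \<in> {1..r}" using step by auto
  have p0: "p t = aty t" if "t \<in> {1..s}" for t using p(2) that by simp
  obtain x where x: "admissible (p(s := x))"
    "deformation (p(s := x)) ((raise_op m n s ^^ \<theta> s) (foldr ?f [Suc s..<r + 1] lam))"
    "walk T (p ` {s<..r}) x = compress T (aty s) + int (\<theta> s)"
    using admissible_raise_pow[OF p(1) p0 s p(3)] by blast
  have im: "(p(s := x)) ` {t<..r} = p ` {t<..r}" if "s \<le> t" for t
    using that by (intro image_cong) auto
  have "[s..<r + 1] = s # [Suc s..<r + 1]" using s by (simp add: upt_conv_Cons del: upt_Suc)
  then have "deformation (p(s := x)) (foldr ?f [s..<r + 1] lam)" using x(2) by simp
  moreover have "walk T ((p(s := x)) ` {t<..r}) ((p(s := x)) t) = compress T (aty t) + int (\<theta> t)"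
    if "t \<in> {s..r}" for t
    using x(3) p(4)[of t] im[of t] that by (cases "t = s") auto
  moreover have "\<forall>t \<in> {1..<s}. (p(s := x)) t = aty t" using p(2) by simp
  ultimately show ?case using x(1) by blast
qed

lemma raise_theta_admissible:
  obtains p where "admissible p"
    "\<And>t. t \<in> {1..r} \<Longrightarrow> walk T (p ` {t<..r}) (p t) = compress T (aty t) + int (\<theta> t)"
    "\<And>lam'. lam' \<in> dominant_weights m n \<Longrightarrow> raise_theta m n \<theta> lam = lam' \<longleftrightarrow>
      typical_tuple m n lam = typical_tuple m n lam' \<and>
      p ` {1..r} = left_entries m n lam' \<inter> right_entries m n lam'"
proof -
  obtain p where p: "admissible p"
    "deformation p (foldr (\<lambda>s \<nu>. (raise_op m n s ^^ \<theta> s) \<nu>) [1..<r + 1] lam)"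
    "\<forall>t \<in> {1..r}. walk T (p ` {t<..r}) (p t) = compress T (aty t) + int (\<theta> t)"
    using admissible_fold[of 1 \<theta>] by auto
  show thesis
    using that[OF p(1)] p(3)
      deformation_dominant_rep[OF p(2) admissible_inj[OF p(1)] admissibleD(3)[OF p(1)]]
    unfolding raise_theta_def by blast
qed

text \<open>Descending recursion on the index: once the higher particles agree, both positions are
  free for the same set, and a free position is determined by its walk value.\<close>

lemma admissible_unique:
  assumes "admissible p" "admissible p'"
    "\<And>t. t \<in> {1..r} \<Longrightarrow> walk T (p ` {t<..r}) (p t) = walk T (p' ` {t<..r}) (p' t)"
    "s \<in> {1..r}"
  shows "p s = p' s"
  using assms(4)
proof (induction "r - s" arbitrary: s rule: less_induct)
  case less
  have "p t = p' t" if "t \<in> {s<..r}" for t using less that by auto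
  then have im: "p ` {s<..r} = p' ` {s<..r}" by (intro image_cong) auto
  show ?case
  proof (rule free_walk_inj)
    show "T \<inter> p ` {s<..r} = {}" using admissible_disjoint[OF assms(1) less.prems] .
    show "p s \<in> free T (p ` {s<..r})" using admissibleD(2)[OF assms(1) less.prems] .
    show "p' s \<in> free T (p ` {s<..r})" using admissibleD(2)[OF assms(2) less.prems] im by simp
    show "walk T (p ` {s<..r}) (p s) = walk T (p ` {s<..r}) (p' s)"
      using assms(3)[OF less.prems] im by simp
  qed (use finite_typical_entries in auto)
qed

text \<open>This guarantees a nonnegative number of jumps for every admissible
  configuration.\<close>

lemma admissible_walk_ge:
  assumes "admissible p" "s \<in> {1..r}"
  shows "compress T (aty s) \<le> walk T (p ` {s<..r}) (p s)"
proof (cases "aty s = p s")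
  case True
  then show ?thesis using walk_aty[OF assms] by simp
next
  case False
  then have "aty s < p s" using admissibleD(1)[OF assms] by simp
  then have "walk T (p ` {s<..r}) (aty s) \<le> walk T (p ` {s<..r}) (p s)"
    using admissibleD(2)[OF assms] unfolding free_def by blast
  then show ?thesis using walk_aty[OF assms] by simp
qed

text \<open>By \<open>height_eq\<close>, the bound \<open>u - s\<close> on height differences
  becomes \<open>2 * (u - s)\<close> on compressed coordinates: a walk with particles at all the
  entries from \<open>s\<close> to \<open>u - 1\<close> is then lower at entry \<open>u\<close> than
  at entry \<open>s\<close>.\<close>

lemma c_hat_iff:
  assumes "s \<in> {1..r}" "t \<in> {1..r}"
  shows "c_hat m n lam s t = 1 \<longleftrightarrow>
    (\<forall>u \<in> {s<..t}. compress T (aty u) - compress T (aty s) < 2 * int u - 2 * int s)"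
proof -
  have "c_rel m n lam s u = 1 \<longleftrightarrow> u = s \<or> compress T (aty u) - compress T (aty s) < 2 * int u - 2 * int s"
    if "u \<in> {s..t}" for u
    using height_eq[OF assms(1)] height_eq[of u] that assms
    by (auto simp: c_rel_def height_dist_def)
  then have "c_hat m n lam s t = 1 \<longleftrightarrow>
      (\<forall>u \<in> {s..t}. u = s \<or> compress T (aty u) - compress T (aty s) < 2 * int u - 2 * int s)"
    by (simp add: c_hat_def)
  also have "\<dots> \<longleftrightarrow> (\<forall>u \<in> {s<..t}. compress T (aty u) - compress T (aty s) < 2 * int u - 2 * int s)"
    by fastforce
  finally show ?thesis .
qed

lemma aty_between:
  assumes "i \<in> {1..r}" "j \<in> {1..r}" "i \<le> j"
  shows "{x \<in> aty ` {1..r}. aty i \<le> x \<and> x < aty j} = aty ` {i..<j}"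
  using assms aty_less_iff[OF _ assms(2)] aty_le_iff[OF assms(1)] by auto

lemma card_aty_between:
  assumes "i \<in> {1..r}" "j \<in> {1..r}"
  shows "card (aty ` {i..<j}) = j - i"
proof -
  have "{i..<j} \<subseteq> {1..r}" using assms by auto
  then show ?thesis using inj_on_subset[OF inj_aty] by (simp add: card_image)
qed

text \<open>The particle with index \<open>inv \<sigma> j\<close> ends at the \<open>j\<close>-th
  atypical entry. That entry fails to be free exactly when a particle of higher index sits at an
  entry \<open>i\<close> below it from which the walk descends and does not recover up to
  \<open>j\<close>, and this is the relation \<open>c_hat\<close>.\<close>

lemma free_iff_linear_extension:
  assumes \<sigma>: "\<sigma> permutes {1..r}"
  shows "(\<forall>s \<in> {1..r}. aty (\<sigma> s) \<in> free T ((\<lambda>t. aty (\<sigma> t)) ` {s<..r})) \<longleftrightarrow>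
    (\<forall>i \<in> {1..r}. \<forall>j \<in> {1..r}. i < j \<and> c_hat m n lam i j = 1 \<longrightarrow> inv \<sigma> i < inv \<sigma> j)"
proof -
  let ?p = "\<lambda>t. aty (\<sigma> t)"
  note finT = finite_typical_entries[of m n lam]
  have inr: "\<sigma> s \<in> {1..r}" "inv \<sigma> s \<in> {1..r}" if "s \<in> {1..r}" for s
    using that permutes_in_image[OF \<sigma>] permutes_in_image[OF permutes_inv[OF \<sigma>]] by blast+
  have inv: "\<sigma> (inv \<sigma> s) = s" "inv \<sigma> (\<sigma> s) = s" for s
    using permutes_inverses[OF \<sigma>] by auto
  have sub: "?p ` {s<..r} \<subseteq> aty ` {1..r}" for s
  proof
    fix x assume "x \<in> ?p ` {s<..r}"
    then obtain t where "t \<in> {s<..r}" "x = ?p t" by blast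
    then have "t \<in> {1..r}" "x = ?p t" by auto
    then show "x \<in> aty ` {1..r}" using inr(1) by blast
  qed
  show ?thesis
  proof (intro iffI ballI impI)
    fix i j
    assume free: "\<forall>s \<in> {1..r}. ?p s \<in> free T (?p ` {s<..r})"
      and i: "i \<in> {1..r}" and j: "j \<in> {1..r}" and ij: "i < j \<and> c_hat m n lam i j = 1"
    show "inv \<sigma> i < inv \<sigma> j"
    proof (rule ccontr)
      assume bad: "\<not> inv \<sigma> i < inv \<sigma> j"
      \<comment> \<open>Take the least entry \<open>k\<close> violating the order relative to
        \<open>i\<close>. All entries from \<open>i\<close> up to \<open>k - 1\<close> then carry
        particles of index higher than \<open>inv \<sigma> k\<close>, so each of them lowers the
        walk.\<close>
      define P where "P j \<longleftrightarrow> j \<in> {1..r} \<and> i < j \<and> c_hat m n lam i j = 1 \<and> \<not> inv \<sigma> i < inv \<sigma> j" for j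
      define k where "k = Least P"
      have "P j" using i j ij bad by (simp add: P_def)
      then have "P k" unfolding k_def by (rule LeastI)
      then have k: "k \<in> {1..r}" "i < k" "c_hat m n lam i k = 1" "\<not> inv \<sigma> i < inv \<sigma> k"
        by (auto simp: P_def)
      have before: "inv \<sigma> k < inv \<sigma> u" if u: "u \<in> {i..<k}" for u
      proof (cases "u = i")
        case True
        have "inv \<sigma> k \<noteq> inv \<sigma> i" using k(2) inv by (metis nat_less_le)
        then show ?thesis using k(4) True by simp
      next
        case False
        then have u': "u \<in> {1..r}" "i < u" using u k(1) by auto
        have "c_hat m n lam i u = 1"
          using k(3) u unfolding c_hat_iff[OF i k(1)] c_hat_iff[OF i u'(1)] by auto
        moreover have "\<not> P u" using u not_less_Least[of u P] by (simp add: k_def)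
        ultimately have "inv \<sigma> i < inv \<sigma> u" using u' by (simp add: P_def)
        then show ?thesis using k(4) by simp
      qed
      define Q where "Q = ?p ` {inv \<sigma> k<..r}"
      define c where "c = int (card {x \<in> Q. aty i \<le> x \<and> x < aty k})"
      have "aty ` {i..<k} \<subseteq> Q"
      proof
        fix x assume "x \<in> aty ` {i..<k}"
        then obtain u where u: "u \<in> {i..<k}" "x = aty u" by blast
        have "u \<in> {1..r}" using u(1) i k(1) by auto
        then have "inv \<sigma> u \<in> {inv \<sigma> k<..r}" using before[OF u(1)] inr(2)[of u] by simp
        then show "x \<in> Q" unfolding Q_def using u(2) inv(1)[of u] by (intro image_eqI[of _ _ "inv \<sigma> u"]) auto
      qed
      then have "aty ` {i..<k} \<subseteq> {x \<in> Q. aty i \<le> x \<and> x < aty k}"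
        using aty_between[OF i k(1)] k(2) by (simp add: subset_iff) blast
      then have "card (aty ` {i..<k}) \<le> card {x \<in> Q. aty i \<le> x \<and> x < aty k}"
        by (rule card_mono[rotated]) (simp add: Q_def)
      then have "int k - int i \<le> c"
        unfolding card_aty_between[OF i k(1)] c_def by simp
      moreover have "aty k \<in> free T Q"
        unfolding Q_def using free inr(2)[OF k(1)] inv(1)[of k] by metis
      then have "walk T Q (aty i) \<le> walk T Q (aty k)"
        using aty_less[OF i k(1,2)] unfolding free_def by blast
      moreover have "walk T Q (aty k) - walk T Q (aty i) = compress T (aty k) - compress T (aty i)
          - 2 * c"
        unfolding c_def using aty_less[OF i k(1,2)] by (intro walk_diff) (auto simp: Q_def)
      moreover have "compress T (aty k) - compress T (aty i) < 2 * int k - 2 * int i"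
        using k(2,3) unfolding c_hat_iff[OF i k(1)] by auto
      ultimately show False using k(2) by linarith
    qed
  next
    fix s
    assume ext: "\<forall>i \<in> {1..r}. \<forall>j \<in> {1..r}. i < j \<and> c_hat m n lam i j = 1 \<longrightarrow> inv \<sigma> i < inv \<sigma> j"
      and s: "s \<in> {1..r}"
    define Q where "Q = ?p ` {s<..r}"
    have subQ: "Q \<subseteq> aty ` {1..r}" and finQ: "finite Q" using sub[of s] by (auto simp: Q_def)
    let ?j = "\<sigma> s"
    have j: "?j \<in> {1..r}" using inr(1)[OF s] .
    have "x \<notin> T" if "x \<in> aty ` {1..r}" for x using that aty_notin_T by auto
    then have disj: "T \<inter> Q = {}" using subQ by blast
    have notin: "aty ?j \<notin> Q"
    proof
      assume "aty ?j \<in> Q"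
      then obtain t where t: "t \<in> {s<..r}" "aty ?j = aty (\<sigma> t)" unfolding Q_def by blast
      then have "\<sigma> s = \<sigma> t" using j inr(1)[of t] inj_onD[OF inj_aty] by auto
      then show False using t(1) inv(2)[of s] inv(2)[of t] by simp
    qed
    have "walk T Q q \<le> walk T Q (aty ?j)" if "q < aty ?j" for q
    proof (rule ccontr)
      assume bad: "\<not> walk T Q q \<le> walk T Q (aty ?j)"
      let ?B = "{q' \<in> {q..<aty ?j}. walk T Q (aty ?j) < walk T Q q'}"
      \<comment> \<open>The last position below \<open>aty ?j\<close> at which the walk is still too
        high. The walk steps down there, so a particle of higher index sits at
        \<open>z\<close>.\<close>
      define z where "z = Max ?B"
      have fin: "finite ?B" by (rule finite_subset[of _ "{q..<aty ?j}"]) auto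
      have "q \<in> ?B" using bad that by auto
      then have "z \<in> ?B" unfolding z_def using fin by (intro Max_in) auto
      then have z: "q \<le> z" "z < aty ?j" "walk T Q (aty ?j) < walk T Q z" by auto
      have above: "walk T Q w \<le> walk T Q (aty ?j)" if "z < w" "w \<le> aty ?j" for w
      proof (rule ccontr)
        assume "\<not> ?thesis"
        then have "w \<in> ?B" using that z(1) by (cases "w = aty ?j") auto
        then have "w \<le> z" unfolding z_def using fin by (intro Max_ge)
        then show False using that by simp
      qed
      have "walk T Q (z + 1) < walk T Q z" using above[of "z + 1"] z by simp
      then have "z \<in> Q"
        using walk_Suc[OF finT finQ disj, of z] by (auto split: if_splits)
      then obtain t where t: "t \<in> {s<..r}" "z = aty (\<sigma> t)" unfolding Q_def by blast
      let ?i = "\<sigma> t"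
      have i: "?i \<in> {1..r}" using inr(1)[of t] t(1) by auto
      have lt: "?i < ?j" using z(2) t(2) aty_less_iff[OF i j] by simp
      have "c_hat m n lam ?i ?j = 1" unfolding c_hat_iff[OF i j]
      proof
        \<comment> \<open>After \<open>z\<close> the walk stays lower, yet at most
          \<open>u - ?i\<close> particles contribute to the descent, with weight 2 each; this bounds
          the compressed distance.\<close>
        fix u assume u: "u \<in> {?i<..?j}"
        then have u': "u \<in> {1..r}" "?i < u" "u \<le> ?j" using j by auto
        have au: "aty ?i < aty u" "aty u \<le> aty ?j"
          using aty_less[OF i u'(1,2)] aty_le_iff[OF u'(1) j] u'(3) by auto
        let ?X = "{x \<in> Q. aty ?i \<le> x \<and> x < aty u}"
        define c where "c = int (card ?X)"
        have "?X \<subseteq> {x \<in> aty ` {1..r}. aty ?i \<le> x \<and> x < aty u}" using subQ by blast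
        also have "\<dots> = aty ` {?i..<u}" using u'(2) by (intro aty_between[OF i u'(1)]) simp
        finally have "card ?X \<le> card (aty ` {?i..<u})" by (intro card_mono) simp_all
        then have "c \<le> int u - int ?i"
          unfolding card_aty_between[OF i u'(1)] c_def using u'(2) by simp
        moreover have "walk T Q (aty u) - walk T Q (aty ?i)
            = compress T (aty u) - compress T (aty ?i) - 2 * c"
          unfolding c_def using au by (intro walk_diff finQ) auto
        moreover have "walk T Q (aty u) < walk T Q (aty ?i)"
          using above[of "aty u"] z(3) au t(2) by simp
        ultimately show "compress T (aty u) - compress T (aty ?i) < 2 * int u - 2 * int ?i"
          using u'(2) by linarith
      qed
      then have "inv \<sigma> ?i < inv \<sigma> ?j" using ext i j lt by blast
      then show False using t(1) inv(2) by simp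
    qed
    then show "?p s \<in> free T (?p ` {s<..r})"
      using notin aty_notin_T[OF j] unfolding free_def Q_def by blast
  qed
qed

end

section \<open>The recursion for the functions \<open>Z\<^sub>q\<close>\<close>

text \<open>The relation \<open>c_hat\<close> for a bare tuple of heights. The index
  \<open>u = s\<close> is omitted because \<open>c_rel\<close> is 1 there by convention.\<close>

definition nested :: "(nat \<Rightarrow> int) \<Rightarrow> nat \<Rightarrow> nat \<Rightarrow> bool" where
  "nested x s t \<longleftrightarrow> (\<forall>u \<in> {s<..t}. x u - x s < int u - int s)"

text \<open>The permutations in \<open>S_perms_rel\<close>, with heights and bounds as free
  parameters, so that induction on \<open>r\<close> can leave the setting of weights.\<close>

definition bounded_extensions :: "nat \<Rightarrow> (nat \<Rightarrow> int) \<Rightarrow> (nat \<Rightarrow> int) \<Rightarrow> (nat \<Rightarrow> nat) set" where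
  "bounded_extensions r x b =
     {\<sigma>. \<sigma> permutes {1..r} \<and>
         (\<forall>s \<in> {1..r}. \<forall>t \<in> {1..r}. s < t \<and> nested x s t \<longrightarrow> inv \<sigma> s < inv \<sigma> t) \<and>
         (\<forall>s \<in> {1..r}. b s \<le> int (\<sigma> s))}"

definition skip :: "nat \<Rightarrow> nat \<Rightarrow> nat" where
  "skip i k = (if k < i then k else Suc k)"

text \<open>Appends the last value \<open>i\<close> and makes room for it by relabelling; this is
  how permutations with a prescribed last value reduce to smaller ones.\<close>

definition lift_perm :: "nat \<Rightarrow> nat \<Rightarrow> (nat \<Rightarrow> nat) \<Rightarrow> nat \<Rightarrow> nat" where
  "lift_perm i r \<sigma> s = (if s = Suc r then i else if s \<in> {1..r} then skip i (\<sigma> s) else s)"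

text \<open>
  Deletes the \<open>i\<close>-th particle together with the vacancy just right of it; in terms of the positions
  \<open>x j + j\<close> the later particles move by \<open>2\<close> while their index drops by \<open>1\<close>.
\<close>

definition delete_at :: "(nat \<Rightarrow> int) \<Rightarrow> nat \<Rightarrow> nat \<Rightarrow> int" where
  "delete_at x i = (\<lambda>j. if j < i then x j else x (j + 1) - 1)"

lemma skip_less_iff: "skip i k < skip i l \<longleftrightarrow> k < l"
  by (auto simp: skip_def)

lemma skip_neq: "skip i k \<noteq> i"
  by (auto simp: skip_def)

lemma skip_in: "k \<in> {1..r} \<Longrightarrow> skip i k \<in> {1..Suc r}"
  by (auto simp: skip_def)

lemma skip_surj: "v \<noteq> i \<Longrightarrow> \<exists>k. v = skip i k"
  by (rule exI[of _ "if v < i then v else v - 1"]) (auto simp: skip_def)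

text \<open>Restates the order condition without \<open>inv\<close>, which suits the explicit values
  of \<open>lift_perm\<close>.\<close>

lemma inverse_order_iff:
  assumes "\<sigma> permutes {1..r}"
  shows "(\<forall>s \<in> {1..r}. \<forall>t \<in> {1..r}. s < t \<and> R s t \<longrightarrow> inv \<sigma> s < inv \<sigma> t) \<longleftrightarrow>
    (\<forall>a \<in> {1..r}. \<forall>c \<in> {1..r}. \<sigma> a < \<sigma> c \<and> R (\<sigma> a) (\<sigma> c) \<longrightarrow> a < c)"
proof -
  have inr: "\<sigma> a \<in> {1..r}" "inv \<sigma> a \<in> {1..r}" if "a \<in> {1..r}" for a
    using that permutes_in_image[OF assms] permutes_in_image[OF permutes_inv[OF assms]] by blast+
  note inv = permutes_inverses[OF assms]
  show ?thesis
  proof (intro iffI ballI impI)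
    fix a c
    assume A: "\<forall>s \<in> {1..r}. \<forall>t \<in> {1..r}. s < t \<and> R s t \<longrightarrow> inv \<sigma> s < inv \<sigma> t"
      and ac: "a \<in> {1..r}" "c \<in> {1..r}" "\<sigma> a < \<sigma> c \<and> R (\<sigma> a) (\<sigma> c)"
    then have "inv \<sigma> (\<sigma> a) < inv \<sigma> (\<sigma> c)" using inr(1) by blast
    then show "a < c" unfolding inv .
  next
    fix s t
    assume A: "\<forall>a \<in> {1..r}. \<forall>c \<in> {1..r}. \<sigma> a < \<sigma> c \<and> R (\<sigma> a) (\<sigma> c) \<longrightarrow> a < c"
      and st: "s \<in> {1..r}" "t \<in> {1..r}" "s < t \<and> R s t"
    have "\<sigma> (inv \<sigma> s) < \<sigma> (inv \<sigma> t) \<and> R (\<sigma> (inv \<sigma> s)) (\<sigma> (inv \<sigma> t))"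
      unfolding inv by (rule st(3))
    then show "inv \<sigma> s < inv \<sigma> t" using A inr(2) st(1,2) by blast
  qed
qed

lemma bounded_extensions_iff:
  "\<sigma> \<in> bounded_extensions r x b \<longleftrightarrow> \<sigma> permutes {1..r} \<and>
    (\<forall>a \<in> {1..r}. \<forall>c \<in> {1..r}. \<sigma> a < \<sigma> c \<and> nested x (\<sigma> a) (\<sigma> c) \<longrightarrow> a < c) \<and>
    (\<forall>s \<in> {1..r}. b s \<le> int (\<sigma> s))"
  unfolding bounded_extensions_def mem_Collect_eq using inverse_order_iff by blast

lemma finite_bounded_extensions: "finite (bounded_extensions r x b)"
  by (rule finite_subset[of _ "{\<sigma>. \<sigma> permutes {1..r}}"])
    (auto simp: bounded_extensions_def finite_permutations)

lemma bounded_extensions_cong: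
  assumes "\<And>s. s \<in> {1..r} \<Longrightarrow> x s = x' s"
  shows "bounded_extensions r x b = bounded_extensions r x' b"
proof -
  have "nested x s t \<longleftrightarrow> nested x' s t" if "s \<in> {1..r}" "t \<in> {1..r}" for s t
    using assms that by (auto simp: nested_def)
  then show ?thesis unfolding bounded_extensions_def by (intro Collect_cong) (simp cong: conj_cong)
qed

section \<open>Permutations with a prescribed last value\<close>

lemma lift_perm_permutes:
  assumes "\<sigma> permutes {1..r}" "i \<in> {1..Suc r}"
  shows "lift_perm i r \<sigma> permutes {1..Suc r}"
proof (rule bij_imp_permutes)
  have "inj_on (lift_perm i r \<sigma>) {1..Suc r}"
  proof (rule linorder_inj_onI')
    fix s t assume st: "s \<in> {1..Suc r}" "t \<in> {1..Suc r}" "s < t"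
    then have "\<sigma> s \<noteq> \<sigma> t" using permutes_inj[OF assms(1)] by (metis inj_eq nat_less_le)
    then show "lift_perm i r \<sigma> s \<noteq> lift_perm i r \<sigma> t"
      using st skip_neq[of i "\<sigma> s"] by (auto simp: lift_perm_def skip_def)
  qed
  moreover have "lift_perm i r \<sigma> ` {1..Suc r} \<subseteq> {1..Suc r}"
  proof
    fix v assume "v \<in> lift_perm i r \<sigma> ` {1..Suc r}"
    then obtain s where "s \<in> {1..Suc r}" "v = lift_perm i r \<sigma> s" by blast
    then show "v \<in> {1..Suc r}"
      using assms(2) skip_in[of "\<sigma> s" r i] permutes_in_image[OF assms(1), of s]
      by (auto simp: lift_perm_def)
  qed
  ultimately show "bij_betw (lift_perm i r \<sigma>) {1..Suc r} {1..Suc r}"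
    by (intro bij_betw_imageI endo_inj_surj) (simp_all del: atLeastAtMost_iff)
qed (auto simp: lift_perm_def)

lemma lift_perm_surj:
  assumes "\<tau> permutes {1..Suc r}" "\<tau> (Suc r) = i"
  obtains \<sigma> where "\<sigma> permutes {1..r}" "\<tau> = lift_perm i r \<sigma>"
proof
  let ?\<sigma> = "\<lambda>s. if s \<in> {1..r} then (if \<tau> s < i then \<tau> s else \<tau> s - 1) else s"
  have ne: "\<tau> s \<noteq> i" if "s \<in> {1..r}" for s
  proof
    assume "\<tau> s = i"
    then have "\<tau> s = \<tau> (Suc r)" using assms(2) by simp
    then have "s = Suc r" by (rule injD[OF permutes_inj[OF assms(1)]])
    then show False using that by simp
  qed
  have inr: "\<tau> s \<in> {1..Suc r}" if "s \<in> {1..Suc r}" for s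
    using permutes_in_image[OF assms(1)] that by blast
  have i: "i \<in> {1..Suc r}" using inr[of "Suc r"] assms(2) by simp
  show "?\<sigma> permutes {1..r}"
  proof (rule bij_imp_permutes)
    have "inj_on ?\<sigma> {1..r}"
    proof (rule linorder_inj_onI')
      fix s t assume st: "s \<in> {1..r}" "t \<in> {1..r}" "s < t"
      then have "\<tau> s \<noteq> \<tau> t" using permutes_inj[OF assms(1)] by (metis inj_eq nat_less_le)
      then show "?\<sigma> s \<noteq> ?\<sigma> t"
        using st ne[of s] ne[of t] inr[of s] inr[of t] by auto
    qed
    moreover have "?\<sigma> ` {1..r} \<subseteq> {1..r}"
    proof
      fix v assume "v \<in> ?\<sigma> ` {1..r}"
      then obtain s where s: "s \<in> {1..r}" "v = ?\<sigma> s" by blast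
      then show "v \<in> {1..r}" using ne[of s] inr[of s] i by auto
    qed
    ultimately show "bij_betw ?\<sigma> {1..r} {1..r}"
      by (intro bij_betw_imageI endo_inj_surj) simp_all
  qed auto
  show "\<tau> = lift_perm i r ?\<sigma>"
  proof
    fix s
    show "\<tau> s = lift_perm i r ?\<sigma> s"
      using ne[of s] assms permutes_not_in[OF assms(1), of s]
      by (auto simp: lift_perm_def skip_def)
  qed
qed

lemma lift_perm_inj:
  assumes "\<sigma> permutes {1..r}" "\<sigma>' permutes {1..r}" "lift_perm i r \<sigma> = lift_perm i r \<sigma>'"
  shows "\<sigma> = \<sigma>'"
proof
  fix s
  show "\<sigma> s = \<sigma>' s"
  proof (cases "s \<in> {1..r}")
    case True
    then have "skip i (\<sigma> s) = skip i (\<sigma>' s)"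
      using fun_cong[OF assms(3), of s] by (simp add: lift_perm_def)
    then show ?thesis by (auto simp: skip_def split: if_splits)
  qed (use assms(1,2) permutes_not_in in metis)
qed

text \<open>The deletion preserves every \<open>x u - u\<close> under the relabelling
  \<open>skip i\<close>, so the conditions correspond one to one except at the deleted index, where
  the gap supplies the missing one.\<close>

lemma nested_delete_at:
  assumes gap: "i = Suc r \<or> x i + 1 \<le> x (Suc i)" and st: "t \<in> {1..r}"
  shows "nested (delete_at x i) s t \<longleftrightarrow> nested x (skip i s) (skip i t)"
proof -
  have diff: "delete_at x i u - delete_at x i s < int u - int s \<longleftrightarrow>
      x (skip i u) - x (skip i s) < int (skip i u) - int (skip i s)" for u
    by (auto simp: delete_at_def skip_def)
  show ?thesis
  proof
    assume N: "nested (delete_at x i) s t"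
    show "nested x (skip i s) (skip i t)" unfolding nested_def
    proof
      fix v assume v: "v \<in> {skip i s<..skip i t}"
      show "x v - x (skip i s) < int v - int (skip i s)"
      proof (cases "v = i")
        case True
        \<comment> \<open>At the deleted index the gap bounds \<open>x i - i\<close> by the
          corresponding value at \<open>Suc i\<close>, which is covered by nesting after
          deletion.\<close>
        then have "i \<noteq> Suc r" "s < i" "i \<le> t" using v st by (auto simp: skip_def split: if_splits)
        moreover from this have "delete_at x i i - delete_at x i s < int i - int s"
          using N unfolding nested_def by auto
        ultimately show ?thesis using True gap by (auto simp: delete_at_def skip_def)
      next
        case False
        then obtain u where u: "v = skip i u" using skip_surj by blast
        then have "u \<in> {s<..t}" using v skip_less_iff[of i s u] skip_less_iff[of i t u] by auto
        then show ?thesis using N u diff unfolding nested_def by blast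
      qed
    qed
  next
    assume N: "nested x (skip i s) (skip i t)"
    show "nested (delete_at x i) s t" unfolding nested_def
    proof
      fix u assume "u \<in> {s<..t}"
      then have "skip i u \<in> {skip i s<..skip i t}"
        using skip_less_iff[of i s u] skip_less_iff[of i t u] by auto
      then show "delete_at x i u - delete_at x i s < int u - int s"
        using N diff unfolding nested_def by blast
    qed
  qed
qed

text \<open>Relabelling respects the lower bounds because they are at most \<open>i\<close> and only
  values from \<open>i\<close> on are shifted. The appended value creates no violated order
  condition, since by the gap \<open>i\<close> is nested with no larger value.\<close>

lemma lift_perm_extension_iff:
  assumes \<sigma>: "\<sigma> permutes {1..r}" and i: "i \<in> {1..Suc r}"
    and gap: "i = Suc r \<or> x i + 1 \<le> x (Suc i)"
    and b: "\<And>s. s \<in> {1..r} \<Longrightarrow> b s \<le> b (Suc r)" "b (Suc r) \<le> int i"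
  shows "lift_perm i r \<sigma> \<in> bounded_extensions (Suc r) x b \<longleftrightarrow>
    \<sigma> \<in> bounded_extensions r (delete_at x i) b"
proof -
  let ?\<tau> = "lift_perm i r \<sigma>"
  have set: "{1..Suc r} = insert (Suc r) {1..r}" by auto
  have \<tau>: "?\<tau> s = skip i (\<sigma> s)" if "s \<in> {1..r}" for s using that by (simp add: lift_perm_def)
  have \<tau>r: "?\<tau> (Suc r) = i" by (simp add: lift_perm_def)
  have \<sigma>_in: "\<sigma> s \<in> {1..r}" if "s \<in> {1..r}" for s using permutes_in_image[OF \<sigma>] that by blast
  have "(\<forall>a \<in> {1..Suc r}. \<forall>c \<in> {1..Suc r}. ?\<tau> a < ?\<tau> c \<and> nested x (?\<tau> a) (?\<tau> c) \<longrightarrow> a < c) \<longleftrightarrow>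
      (\<forall>a \<in> {1..r}. \<forall>c \<in> {1..r}. \<sigma> a < \<sigma> c \<and> nested (delete_at x i) (\<sigma> a) (\<sigma> c) \<longrightarrow> a < c)"
    (is "?A \<longleftrightarrow> ?B")
  proof
    assume A: ?A
    show ?B
    proof (intro ballI impI)
      fix a c assume ac: "a \<in> {1..r}" "c \<in> {1..r}" and "\<sigma> a < \<sigma> c \<and> nested (delete_at x i) (\<sigma> a) (\<sigma> c)"
      then have "?\<tau> a < ?\<tau> c \<and> nested x (?\<tau> a) (?\<tau> c)"
        using nested_delete_at[OF gap \<sigma>_in[OF ac(2)]] by (simp add: \<tau> skip_less_iff)
      then show "a < c" using A ac unfolding set by blast
    qed
  next
    assume B: ?B
    show ?A
    proof (intro ballI impI)
      fix a c assume ac: "a \<in> {1..Suc r}" "c \<in> {1..Suc r}" and N: "?\<tau> a < ?\<tau> c \<and> nested x (?\<tau> a) (?\<tau> c)"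
      show "a < c"
      proof (cases "a = Suc r")
        case True
        then have c: "c \<in> {1..r}" using ac N by (cases "c = Suc r") auto
        then have "i < skip i (\<sigma> c)" "nested x i (skip i (\<sigma> c))" using N True \<tau>r \<tau> by auto
        then have "x (Suc i) - x i < 1" unfolding nested_def by (auto dest: bspec[of _ _ "Suc i"])
        moreover have "i \<noteq> Suc r"
          using \<open>i < skip i (\<sigma> c)\<close> \<sigma>_in[OF c] by (auto simp: skip_def split: if_splits)
        ultimately show ?thesis using gap by auto
      next
        case False
        then have a: "a \<in> {1..r}" using ac by auto
        show ?thesis
        proof (cases "c = Suc r")
          case False
          then have c: "c \<in> {1..r}" using ac by auto
          have "\<sigma> a < \<sigma> c \<and> nested (delete_at x i) (\<sigma> a) (\<sigma> c)"
            using N nested_delete_at[OF gap \<sigma>_in[OF c]] a c by (simp add: \<tau> skip_less_iff)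
          then show ?thesis using B a c by blast
        qed (use a in auto)
      qed
    qed
  qed
  moreover have "(\<forall>s \<in> {1..Suc r}. b s \<le> int (?\<tau> s)) \<longleftrightarrow> (\<forall>s \<in> {1..r}. b s \<le> int (\<sigma> s))"
  proof -
    have "b s \<le> int (skip i (\<sigma> s)) \<longleftrightarrow> b s \<le> int (\<sigma> s)" if "s \<in> {1..r}" for s
      using b(1)[OF that] b(2) by (auto simp: skip_def)
    then show ?thesis unfolding set using b(2) \<tau> \<tau>r by simp
  qed
  ultimately show ?thesis
    using \<sigma> lift_perm_permutes[OF \<sigma> i] unfolding bounded_extensions_iff by blast
qed

text \<open>If the last value \<open>i\<close> had no gap above it, \<open>i\<close> and
  \<open>Suc i\<close> would be nested, so \<open>i\<close> would have to be taken before
  \<open>Suc i\<close>. This accounts for the factor \<open>step_fun\<close> in the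
  recursion.\<close>

lemma bounded_extension_last:
  assumes "\<tau> \<in> bounded_extensions (Suc r) x b"
  shows "\<tau> (Suc r) \<in> {1..Suc r}" "b (Suc r) \<le> int (\<tau> (Suc r))"
    "\<tau> (Suc r) = Suc r \<or> x (\<tau> (Suc r)) + 1 \<le> x (Suc (\<tau> (Suc r)))"
proof -
  have p: "\<tau> permutes {1..Suc r}" using assms by (simp add: bounded_extensions_def)
  show i: "\<tau> (Suc r) \<in> {1..Suc r}" using permutes_in_image[OF p] by simp
  show "b (Suc r) \<le> int (\<tau> (Suc r))" using assms by (simp add: bounded_extensions_def)
  show "\<tau> (Suc r) = Suc r \<or> x (\<tau> (Suc r)) + 1 \<le> x (Suc (\<tau> (Suc r)))"
  proof (rule ccontr)
    let ?i = "\<tau> (Suc r)"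
    assume "\<not> ?thesis"
    then have ir: "Suc ?i \<in> {1..Suc r}" and "x (Suc ?i) - x ?i < 1" using i by auto
    then have N: "nested x ?i (Suc ?i)" by (auto simp: nested_def le_Suc_eq)
    have "\<forall>s \<in> {1..Suc r}. \<forall>t \<in> {1..Suc r}. s < t \<and> nested x s t \<longrightarrow> inv \<tau> s < inv \<tau> t"
      using assms by (simp add: bounded_extensions_def)
    then have "inv \<tau> ?i < inv \<tau> (Suc ?i)" using i ir N by blast
    moreover have "inv \<tau> (Suc ?i) \<in> {1..Suc r}"
      using permutes_in_image[OF permutes_inv[OF p]] ir by blast
    ultimately show False using permutes_inverses(2)[OF p] by simp
  qed
qed

text \<open>The new inversions pair the last place with the places whose old value is at least
  \<open>i\<close>, and there are \<open>Suc r - i\<close> of them.\<close>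

lemma perm_length_lift_perm:
  assumes \<sigma>: "\<sigma> permutes {1..r}" and i: "i \<in> {1..Suc r}"
  shows "perm_length (Suc r) (lift_perm i r \<sigma>) = perm_length r \<sigma> + (Suc r - i)"
proof -
  let ?\<tau> = "lift_perm i r \<sigma>"
  let ?I = "{(s, t). s \<in> {1..r} \<and> t \<in> {1..r} \<and> s < t \<and> \<sigma> t < \<sigma> s}"
  let ?B = "{s \<in> {1..r}. i \<le> \<sigma> s}"
  have \<tau>: "?\<tau> s = skip i (\<sigma> s)" if "s \<in> {1..r}" for s using that by (simp add: lift_perm_def)
  have \<tau>r: "?\<tau> (Suc r) = i" by (simp add: lift_perm_def)
  have lt: "i < skip i k \<longleftrightarrow> i \<le> k" for k by (auto simp: skip_def)
  have "s \<in> {1..Suc r} \<and> t \<in> {1..Suc r} \<and> s < t \<and> ?\<tau> t < ?\<tau> s \<longleftrightarrow>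
      (s, t) \<in> ?I \<or> (s \<in> ?B \<and> t = Suc r)" for s t
  proof (cases "t = Suc r")
    case True
    then show ?thesis using \<tau>[of s] \<tau>r lt[of "\<sigma> s"] by auto
  next
    case False
    then have "s \<in> {1..Suc r} \<and> t \<in> {1..Suc r} \<and> s < t \<longleftrightarrow> s \<in> {1..r} \<and> t \<in> {1..r} \<and> s < t" by auto
    then show ?thesis using \<tau>[of s] \<tau>[of t] skip_less_iff[of i "\<sigma> t" "\<sigma> s"] False by auto
  qed
  then have eq: "{(s, t). s \<in> {1..Suc r} \<and> t \<in> {1..Suc r} \<and> s < t \<and> ?\<tau> t < ?\<tau> s}
      = ?I \<union> (\<lambda>s. (s, Suc r)) ` ?B" by auto
  have finI: "finite ?I" by (rule finite_subset[of _ "{1..r} \<times> {1..r}"]) auto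
  have "perm_length (Suc r) ?\<tau> = card ?I + card ((\<lambda>s. (s, Suc r)) ` ?B)"
    unfolding perm_length_def eq by (rule card_Un_disjoint) (use finI in auto)
  also have "card ((\<lambda>s. (s, Suc r)) ` ?B) = card ?B" by (rule card_image) (simp add: inj_on_def)
  also have "card ?B = card (\<sigma> ` ?B)"
    by (rule card_image[symmetric]) (use permutes_inj[OF \<sigma>] inj_on_subset in blast)
  also have "\<sigma> ` ?B = \<sigma> ` {1..r} \<inter> {i..}" by auto
  also have "\<dots> = {i..r}" unfolding permutes_image[OF \<sigma>] using i by auto
  finally show ?thesis by (simp add: perm_length_def)
qed

text \<open>Across the seam, monotonicity of the deleted tuple follows from the gap, which
  compensates for the shift by 1.\<close>

lemma Z_admissible_delete_at:
  assumes adm: "Z_admissible (Suc r) x b" and gap: "i = Suc r \<or> x i + 1 \<le> x (Suc i)"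
  shows "Z_admissible r (delete_at x i) b"
proof -
  have x: "x s \<le> x t" if "1 \<le> s" "s \<le> t" "t \<le> Suc r" for s t
    using adm that by (auto simp: Z_admissible_def mono_on_def)
  have "delete_at x i s \<le> delete_at x i t" if "s \<in> {1..r}" "t \<in> {1..r}" "s \<le> t" for s t
  proof (cases "s < i \<and> i \<le> t")
    case True
    then have "x s \<le> x i" "x (Suc i) \<le> x (Suc t)" "i \<noteq> Suc r" using that by (auto intro: x)
    then show ?thesis using True gap by (simp add: delete_at_def)
  next
    case False
    then show ?thesis using that x[of s t] x[of "Suc s" "Suc t"] by (auto simp: delete_at_def)
  qed
  then show ?thesis using adm by (auto simp: Z_admissible_def mono_on_def)
qed

lemma sum_bounded_extensions_last:
  assumes adm: "Z_admissible (Suc r) x b" and i: "i \<in> {1..Suc r}" and b: "b (Suc r) \<le> int i"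
    and gap: "i = Suc r \<or> x i + 1 \<le> x (Suc i)"
  shows "(\<Sum>\<tau> | \<tau> \<in> bounded_extensions (Suc r) x b \<and> \<tau> (Suc r) = i. monom 1 (perm_length (Suc r) \<tau>)) =
    (\<Sum>\<sigma> \<in> bounded_extensions r (delete_at x i) b. monom 1 (perm_length r \<sigma>)) *
      (monom 1 (Suc r - i) :: int poly)"
proof -
  have bm: "b s \<le> b (Suc r)" if "s \<in> {1..r}" for s
    using adm that by (auto simp: Z_admissible_def mono_on_def)
  have iff: "lift_perm i r \<sigma> \<in> bounded_extensions (Suc r) x b \<longleftrightarrow>
      \<sigma> \<in> bounded_extensions r (delete_at x i) b" if "\<sigma> permutes {1..r}" for \<sigma>
    by (rule lift_perm_extension_iff[OF that i gap]) (use bm b in auto)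
  have perm: "\<sigma> permutes {1..r}" if "\<sigma> \<in> bounded_extensions r (delete_at x i) b" for \<sigma>
    using that by (simp add: bounded_extensions_def)
  have "bij_betw (lift_perm i r) (bounded_extensions r (delete_at x i) b)
      {\<tau>. \<tau> \<in> bounded_extensions (Suc r) x b \<and> \<tau> (Suc r) = i}" (is "bij_betw _ ?A ?B")
  proof (intro bij_betw_imageI inj_onI equalityI subsetI)
    fix \<sigma> \<sigma>' assume "\<sigma> \<in> ?A" "\<sigma>' \<in> ?A" "lift_perm i r \<sigma> = lift_perm i r \<sigma>'"
    then show "\<sigma> = \<sigma>'" using lift_perm_inj perm by blast
  next
    fix \<tau> assume "\<tau> \<in> lift_perm i r ` ?A"
    then show "\<tau> \<in> ?B" using iff perm by (auto simp: lift_perm_def)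
  next
    fix \<tau> assume \<tau>: "\<tau> \<in> ?B"
    then have "\<tau> permutes {1..Suc r}" by (simp add: bounded_extensions_def)
    then obtain \<sigma> where "\<sigma> permutes {1..r}" "\<tau> = lift_perm i r \<sigma>" using lift_perm_surj \<tau> by blast
    then show "\<tau> \<in> lift_perm i r ` ?A" using \<tau> iff by blast
  qed
  then have "(\<Sum>\<tau> \<in> ?B. monom 1 (perm_length (Suc r) \<tau>)) =
      (\<Sum>\<sigma> \<in> ?A. monom (1::int) (perm_length (Suc r) (lift_perm i r \<sigma>)))"
    by (rule sum.reindex_bij_betw[symmetric])
  also have "\<dots> = (\<Sum>\<sigma> \<in> ?A. monom 1 (perm_length r \<sigma>) * monom 1 (Suc r - i))"
    using perm_length_lift_perm[OF perm i] by (intro sum.cong refl) (simp add: mult_monom)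
  finally show ?thesis by (simp add: sum_distrib_right)
qed

text \<open>Induction on \<open>r\<close>, grouping by last value: \<open>Suc r\<close> gives the
  leading term of the recursion and a smaller \<open>i\<close> its \<open>i\<close>-th
  summand.\<close>

lemma sum_bounded_extensions:
  assumes "Z_admissible r x b"
  shows "(\<Sum>\<sigma> \<in> bounded_extensions r x b. monom 1 (perm_length r \<sigma>)) = Z_fun r x b"
  using assms
proof (induction r arbitrary: x)
  case 0
  have "bounded_extensions 0 x b = {id}" by (auto simp: bounded_extensions_def)
  moreover have "perm_length 0 \<sigma> = 0" for \<sigma> by (simp add: perm_length_def)
  ultimately show ?case by simp
next
  case (Suc r)
  let ?E = "bounded_extensions (Suc r) x b"
  define F where "F i = (\<Sum>\<tau> | \<tau> \<in> ?E \<and> \<tau> (Suc r) = i. monom (1::int) (perm_length (Suc r) \<tau>))" for i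
  have b: "1 \<le> b (Suc r)" "b (Suc r) \<le> int (Suc r)"
    using Suc.prems unfolding Z_admissible_def by (metis atLeastAtMost_iff le_add1 order_refl plus_1_eq_Suc)+
  have Z: "F i = Z_fun r (delete_at x i) b * monom 1 (Suc r - i)"
    if "i \<in> {1..Suc r}" "b (Suc r) \<le> int i" "i = Suc r \<or> x i + 1 \<le> x (Suc i)" for i
    unfolding F_def sum_bounded_extensions_last[OF Suc.prems that]
    using Suc.IH[OF Z_admissible_delete_at[OF Suc.prems that(3)]] by simp
  have zero: "F i = 0" if "b (Suc r) > int i \<or> \<not> (i = Suc r \<or> x i + 1 \<le> x (Suc i))" for i
  proof -
    have "{\<tau>. \<tau> \<in> ?E \<and> \<tau> (Suc r) = i} = {}" using that bounded_extension_last[of _ r x b] by force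
    then show ?thesis unfolding F_def by (simp only: sum.empty)
  qed
  have "Z_admissible r x b" using Suc.prems by (auto simp: Z_admissible_def mono_on_def)
  then have "Z_fun r x b = (\<Sum>\<sigma> \<in> bounded_extensions r x b. monom 1 (perm_length r \<sigma>))"
    by (rule Suc.IH[symmetric])
  \<comment> \<open>Deleting the last index leaves \<open>x\<close> unchanged on
    \<open>{1..r}\<close>, which identifies the leading term with the class of last value
    \<open>Suc r\<close>.\<close>
  also have "bounded_extensions r x b = bounded_extensions r (delete_at x (Suc r)) b"
    by (rule bounded_extensions_cong) (simp add: delete_at_def)
  also have "(\<Sum>\<sigma> \<in> \<dots>. monom 1 (perm_length r \<sigma>)) = F (Suc r)"
    using Z[of "Suc r"] Suc.IH[OF Z_admissible_delete_at[OF Suc.prems, of "Suc r"]] b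
    by (simp add: monom_0 one_pCons[symmetric])
  finally have last: "F (Suc r) = Z_fun r x b" by simp
  have summand: "F i = step_fun (x (i + 1) - x i - 1) *
      Z_fun r (\<lambda>j. if j < i then x j else x (j + 1) - 1) b * monom 1 (Suc r - i)"
    if "i \<in> {nat (b (Suc r))..r}" for i
  proof (cases "x i + 1 \<le> x (Suc i)")
    case True
    moreover have "i \<in> {1..Suc r}" "b (Suc r) \<le> int i" using that b by auto
    ultimately show ?thesis using Z[of i] by (simp add: step_fun_def delete_at_def)
  next
    case False
    then have "F i = 0" using zero[of i] that by auto
    then show ?thesis using False by (simp add: step_fun_def)
  qed
  have "(\<Sum>\<tau> \<in> ?E. monom 1 (perm_length (Suc r) \<tau>)) = (\<Sum>i \<in> {1..Suc r}. F i)"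
    unfolding F_def
    by (rule sum.group[symmetric]) (use finite_bounded_extensions bounded_extension_last(1) in auto)
  also have "\<dots> = F (Suc r) + (\<Sum>i \<in> {1..r}. F i)" by (simp add: add.commute)
  also have "(\<Sum>i \<in> {1..r}. F i) = (\<Sum>i \<in> {nat (b (Suc r))..r}. F i)"
  proof (rule sum.mono_neutral_right)
    show "\<forall>i \<in> {1..r} - {nat (b (Suc r))..r}. F i = 0"
    proof
      fix i assume "i \<in> {1..r} - {nat (b (Suc r))..r}"
      then show "F i = 0" by (intro zero) (use b in auto)
    qed
  qed (use b in auto)
  finally show ?case using last summand Suc.prems by simp
qed

section \<open>Comparing two weights\<close>

lemma poly_to_fls_sum_monom:
  "poly_to_fls (\<Sum>x\<in>A. monom 1 (f x)) = (\<Sum>x\<in>A. fls_X_intpow (int (f x)))"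
proof -
  have add: "poly_to_fls (p + q) = poly_to_fls p + poly_to_fls q" for p q
    by (simp add: poly_to_fls_def fps_of_poly_add)
  have monom: "poly_to_fls (monom 1 k) = fls_X_intpow (int k)" for k
    by (simp add: poly_to_fls_def fps_of_poly_monom' fps_to_fls_power fls_X_power_conv_shift_1)
  show ?thesis
    by (induction A rule: infinite_finite_induct) (simp_all add: add monom poly_to_fls_def[of 0])
qed

lemma poly_at_q_powi_sum_monom:
  "poly_at_q_powi (\<Sum>x\<in>A. monom 1 (f x)) i = (\<Sum>x\<in>A. fls_X_intpow (i * int (f x)))"
proof -
  have map_add: "map_poly fls_const (p + q) = map_poly fls_const p + map_poly fls_const q"
    for p q :: "int poly"
    by (rule poly_eqI) (simp add: coeff_map_poly fls_plus_const)
  have add: "poly_at_q_powi (p + q) i = poly_at_q_powi p i + poly_at_q_powi q i" for p q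
    by (simp add: poly_at_q_powi_def map_add)
  have monom: "poly_at_q_powi (monom 1 k) i = fls_X_intpow (i * int k)" for k
    by (simp add: poly_at_q_powi_def map_poly_monom poly_monom fls_X_intpow_power mult.commute)
  show ?thesis
    by (induction A rule: infinite_finite_induct) (simp_all add: add monom poly_at_q_powi_def[of 0])
qed

text \<open>Evaluation at 1 counts the terms, so nothing can cancel.\<close>

lemma sum_monom_nonzero:
  assumes "finite A" "A \<noteq> {}"
  shows "(\<Sum>x\<in>A. monom (1::int) (f x)) \<noteq> 0"
proof
  assume "(\<Sum>x\<in>A. monom (1::int) (f x)) = 0"
  then have "poly (\<Sum>x\<in>A. monom (1::int) (f x)) 1 = 0" by simp
  then show False using assms by (simp add: poly_sum poly_monom)
qed

lemma perm_length_eq_sum: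
  "perm_length r \<sigma> = (\<Sum>s = 1..r. card {t \<in> {s<..r}. \<sigma> t < \<sigma> s})"
proof -
  have "{(s, t). s \<in> {1..r} \<and> t \<in> {1..r} \<and> s < t \<and> \<sigma> t < \<sigma> s}
      = (SIGMA s:{1..r}. {t \<in> {s<..r}. \<sigma> t < \<sigma> s})" by auto
  then show ?thesis unfolding perm_length_def by (simp only:) (rule card_SigmaI, auto)
qed

section \<open>Starting weight \<mu> (prefix \<open>u\<close>) and target weight \<open>lam\<close>
  (prefix \<open>l\<close>)\<close>

locale dominant_pair = l: dominant_weight m n lam + u: dominant_weight m n \<mu>
  for m n :: nat and lam \<mu> :: "nat \<Rightarrow> int"
begin

lemma raise_theta_positions:
  obtains p where "u.admissible p"
    "\<And>t. t \<in> {1..u.r} \<Longrightarrow> walk u.T (p ` {t<..u.r}) (p t) = compress u.T (u.aty t) + int (\<theta> t)"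
    "raise_theta m n \<theta> \<mu> = lam \<longleftrightarrow>
      typical_tuple m n \<mu> = typical_tuple m n lam \<and> p ` {1..u.r} = l.aty ` {1..l.r}"
proof (rule u.raise_theta_admissible[of \<theta>])
  fix p assume p: "u.admissible p"
    "\<And>t. t \<in> {1..u.r} \<Longrightarrow> walk u.T (p ` {t<..u.r}) (p t) = compress u.T (u.aty t) + int (\<theta> t)"
    "\<And>lam'. lam' \<in> dominant_weights m n \<Longrightarrow> raise_theta m n \<theta> \<mu> = lam' \<longleftrightarrow>
      typical_tuple m n \<mu> = typical_tuple m n lam' \<and>
      p ` {1..u.r} = left_entries m n lam' \<inter> right_entries m n lam'"
  show thesis using that[OF p(1,2)] p(3)[OF l.dominant] unfolding l.aty_image by blast
qed

text \<open>Pigeonhole: if \<open>u.aty s\<close> exceeded \<open>l.aty s\<close>, the particles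
  \<open>s, ..., r\<close>, which only move right, would need \<open>r - s + 1\<close> distinct
  target entries right of \<open>l.aty s\<close>, where only \<open>r - s\<close> exist.\<close>

lemma weight_leI:
  assumes r: "u.r = l.r" and rep: "raise_theta m n \<theta> \<mu> = lam"
  shows "weight_le m n \<mu> lam"
proof -
  obtain p where adm: "u.admissible p"
    and "\<And>t. t \<in> {1..u.r} \<Longrightarrow> walk u.T (p ` {t<..u.r}) (p t) = compress u.T (u.aty t) + int (\<theta> t)"
    and iff: "raise_theta m n \<theta> \<mu> = lam \<longleftrightarrow>
      typical_tuple m n \<mu> = typical_tuple m n lam \<and> p ` {1..u.r} = l.aty ` {1..l.r}"
    using raise_theta_positions[of \<theta>] by blast
  have tuples: "typical_tuple m n \<mu> = typical_tuple m n lam" and im: "p ` {1..u.r} = l.aty ` {1..l.r}"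
    using iff rep by blast+
  have "u.aty s \<le> l.aty s" if s: "s \<in> {1..l.r}" for s
  proof (rule ccontr)
    assume lt: "\<not> u.aty s \<le> l.aty s"
    have "p ` {s..l.r} \<subseteq> l.aty ` {s<..l.r}"
    proof
      fix x assume "x \<in> p ` {s..l.r}"
      then obtain t where t: "t \<in> {s..l.r}" "x = p t" by blast
      then have t': "t \<in> {1..l.r}" using s by simp
      then have "u.aty s \<le> p t"
        using u.aty_le_iff[of s t] u.admissibleD(1)[OF adm, of t] s t(1) r by simp
      then have x: "l.aty s < x" using lt t(2) by simp
      have "x \<in> l.aty ` {1..l.r}"
        unfolding im[symmetric] r t(2) using t' by (rule imageI)
      then obtain j where j: "j \<in> {1..l.r}" "x = l.aty j" by blast
      then have "s < j" using x l.aty_less_iff[OF s] by simp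
      then show "x \<in> l.aty ` {s<..l.r}" using j by simp
    qed
    then have "card (p ` {s..l.r}) \<le> card (l.aty ` {s<..l.r})" by (intro card_mono) simp_all
    also have "\<dots> \<le> card {s<..l.r}" by (rule card_image_le) simp
    also have "card (p ` {s..l.r}) = card {s..l.r}"
    proof (rule card_image)
      show "inj_on p {s..l.r}"
        by (rule inj_on_subset[OF u.admissible_inj[OF adm]]) (use s r in auto)
    qed
    finally show False using s by (simp add: Suc_diff_le)
  qed
  then show ?thesis using tuples r by (simp add: weight_le_def)
qed

end

locale comparable_pair = dominant_pair +
  assumes weight_le: "weight_le m n \<mu> lam"
begin

lemma r_eq: "u.r = l.r"
  using weight_le by (simp add: weight_le_def)

lemma typical_tuple_eq: "typical_tuple m n \<mu> = typical_tuple m n lam"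
  using weight_le by (simp add: weight_le_def)

lemma T_eq: "u.T = l.T"
  using typical_tuple_eq unfolding typical_tuple_eq_iff[OF l.dominant u.dominant] typical_entries_def
  by simp

lemma aty_le: "s \<in> {1..l.r} \<Longrightarrow> u.aty s \<le> l.aty s"
  using weight_le by (simp add: weight_le_def)

text \<open>The order condition becomes freeness by \<open>free_iff_linear_extension\<close>, and
  the comparison with \<mu> says that no particle ends left of its start.\<close>

lemma S_perms_rel_iff:
  "\<sigma> \<in> S_perms_rel m n lam \<mu> \<longleftrightarrow> \<sigma> permutes {1..l.r} \<and> u.admissible (\<lambda>s. l.aty (\<sigma> s))"
  using l.free_iff_linear_extension[of \<sigma>]
  unfolding S_perms_rel_def S_perms_def u.admissible_def r_eq T_eq by blast

lemma finite_S_perms_rel: "finite (S_perms_rel m n lam \<mu>)"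
proof (rule finite_subset)
  show "S_perms_rel m n lam \<mu> \<subseteq> {\<sigma>. \<sigma> permutes {1..l.r}}" using S_perms_rel_iff by blast
qed (simp add: finite_permutations)

lemma id_in_S_perms_rel: "id \<in> S_perms_rel m n lam \<mu>"
  using aty_le by (simp add: S_perms_rel_def S_perms_def permutes_id)

lemma aty_perm_image: "\<sigma> permutes {1..l.r} \<Longrightarrow> (\<lambda>s. l.aty (\<sigma> s)) ` {1..l.r} = l.aty ` {1..l.r}"
  by (metis image_image permutes_image)

text \<open>The jumps of each particle, computed as the gain in walk height. By
  \<open>walk_theta_of\<close>, \<open>nat\<close> truncates nothing for permutations in
  \<open>S_perms_rel\<close>; \<open>restrict\<close> places the result in the extensional function
  space of \<open>KL_poly\<close>.\<close>

definition theta_of :: "(nat \<Rightarrow> nat) \<Rightarrow> nat \<Rightarrow> nat" where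
  "theta_of \<sigma> = restrict (\<lambda>s. nat (walk l.T ((\<lambda>t. l.aty (\<sigma> t)) ` {s<..l.r}) (l.aty (\<sigma> s))
     - compress l.T (u.aty s))) {1..l.r}"

lemma walk_theta_of:
  assumes "\<sigma> \<in> S_perms_rel m n lam \<mu>" "s \<in> {1..l.r}"
  shows "walk l.T ((\<lambda>t. l.aty (\<sigma> t)) ` {s<..l.r}) (l.aty (\<sigma> s)) =
    compress l.T (u.aty s) + int (theta_of \<sigma> s)"
  using u.admissible_walk_ge[of "\<lambda>s. l.aty (\<sigma> s)" s] assms S_perms_rel_iff
  by (simp add: theta_of_def r_eq T_eq)

text \<open>The configuration reached by these jumps and the one given by \<sigma> are both
  admissible with the same walk values, hence equal by \<open>admissible_unique\<close>.\<close>

lemma raise_theta_of: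
  assumes \<sigma>: "\<sigma> \<in> S_perms_rel m n lam \<mu>"
  shows "raise_theta m n (theta_of \<sigma>) \<mu> = lam"
proof -
  let ?q = "\<lambda>s. l.aty (\<sigma> s)"
  have perm: "\<sigma> permutes {1..l.r}" and adm: "u.admissible ?q" using \<sigma> S_perms_rel_iff by blast+
  obtain p where p: "u.admissible p"
    "\<And>t. t \<in> {1..u.r} \<Longrightarrow>
      walk u.T (p ` {t<..u.r}) (p t) = compress u.T (u.aty t) + int (theta_of \<sigma> t)"
    "raise_theta m n (theta_of \<sigma>) \<mu> = lam \<longleftrightarrow>
      typical_tuple m n \<mu> = typical_tuple m n lam \<and> p ` {1..u.r} = l.aty ` {1..l.r}"
    using raise_theta_positions[of "theta_of \<sigma>"] by blast
  have "p s = ?q s" if "s \<in> {1..u.r}" for s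
  proof (rule u.admissible_unique[OF p(1) adm _ that])
    fix t assume t: "t \<in> {1..u.r}"
    show "walk u.T (p ` {t<..u.r}) (p t) = walk u.T (?q ` {t<..u.r}) (?q t)"
      using p(2)[OF t] walk_theta_of[OF \<sigma>, of t] t by (simp add: r_eq T_eq)
  qed
  then have "p ` {1..u.r} = ?q ` {1..u.r}" by (rule image_cong[OF refl])
  then have "p ` {1..u.r} = l.aty ` {1..l.r}"
    using aty_perm_image[OF perm] r_eq by simp
  then show ?thesis using p(3) typical_tuple_eq by blast
qed

lemma theta_of_surj:
  assumes \<theta>: "\<theta> \<in> {1..l.r} \<rightarrow>\<^sub>E UNIV" and rep: "raise_theta m n \<theta> \<mu> = lam"
  shows "\<theta> \<in> theta_of ` S_perms_rel m n lam \<mu>"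
proof -
  obtain p where p: "u.admissible p"
    "\<And>t. t \<in> {1..u.r} \<Longrightarrow> walk u.T (p ` {t<..u.r}) (p t) = compress u.T (u.aty t) + int (\<theta> t)"
    and iff: "raise_theta m n \<theta> \<mu> = lam \<longleftrightarrow>
      typical_tuple m n \<mu> = typical_tuple m n lam \<and> p ` {1..u.r} = l.aty ` {1..l.r}"
    using raise_theta_positions[of \<theta>] by blast
  have p_image: "p ` {1..u.r} = l.aty ` {1..l.r}"
    using iff rep by blast
  \<comment> \<open>\<sigma> records which atypical entry of \<open>lam\<close> each particle
    finally occupies.\<close>
  define \<sigma> where "\<sigma> s = (if s \<in> {1..l.r} then inv_into {1..l.r} l.aty (p s) else s)" for s
  have "bij_betw p {1..l.r} (l.aty ` {1..l.r})"
    using u.admissible_inj[OF p(1)] p_image r_eq by (simp add: bij_betw_def)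
  then have "bij_betw (inv_into {1..l.r} l.aty \<circ> p) {1..l.r} {1..l.r}"
    by (rule bij_betw_trans)
      (rule bij_betw_inv_into[OF inj_on_imp_bij_betw[OF l.inj_aty]])
  also have "bij_betw (inv_into {1..l.r} l.aty \<circ> p) {1..l.r} {1..l.r} = bij_betw \<sigma> {1..l.r} {1..l.r}"
    by (rule bij_betw_cong) (simp add: \<sigma>_def)
  finally have perm: "\<sigma> permutes {1..l.r}" by (rule bij_imp_permutes) (auto simp: \<sigma>_def)
  have p\<sigma>: "l.aty (\<sigma> s) = p s" if "s \<in> {1..l.r}" for s
  proof -
    have "p s \<in> l.aty ` {1..l.r}" unfolding p_image[symmetric] r_eq using that by (rule imageI)
    then show ?thesis using that by (simp add: \<sigma>_def f_inv_into_f)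
  qed
  have im: "(\<lambda>t. l.aty (\<sigma> t)) ` {s<..l.r} = p ` {s<..l.r}" for s
    using p\<sigma> by (intro image_cong) auto
  have "u.admissible (\<lambda>s. l.aty (\<sigma> s))"
    using p(1) p\<sigma> im unfolding u.admissible_def r_eq by simp
  then have \<sigma>: "\<sigma> \<in> S_perms_rel m n lam \<mu>" using perm S_perms_rel_iff by blast
  have "theta_of \<sigma> = \<theta>"
  proof
    fix s
    show "theta_of \<sigma> s = \<theta> s"
    proof (cases "s \<in> {1..l.r}")
      case True
      then show ?thesis
        using p(2)[of s] walk_theta_of[OF \<sigma> True] p\<sigma>[OF True] im[of s] by (simp add: r_eq T_eq)
    next
      case False
      then show ?thesis using PiE_arb[OF \<theta> False]
        by (simp only: theta_of_def restrict_apply if_False)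
    qed
  qed
  then show ?thesis using \<sigma> by blast
qed

lemma theta_of_inj: "inj_on theta_of (S_perms_rel m n lam \<mu>)"
proof (rule inj_onI)
  fix \<sigma> \<tau> assume \<sigma>: "\<sigma> \<in> S_perms_rel m n lam \<mu>" and \<tau>: "\<tau> \<in> S_perms_rel m n lam \<mu>"
    and eq: "theta_of \<sigma> = theta_of \<tau>"
  have p: "\<sigma> permutes {1..l.r}" "\<tau> permutes {1..l.r}" using \<sigma> \<tau> S_perms_rel_iff by blast+
  show "\<sigma> = \<tau>"
  proof
    fix s
    show "\<sigma> s = \<tau> s"
    proof (cases "s \<in> {1..l.r}")
      case True
      have "l.aty (\<sigma> s) = l.aty (\<tau> s)"
      proof (rule u.admissible_unique[of "\<lambda>s. l.aty (\<sigma> s)" "\<lambda>s. l.aty (\<tau> s)"])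
        fix t assume "t \<in> {1..u.r}"
        then show "walk u.T ((\<lambda>s. l.aty (\<sigma> s)) ` {t<..u.r}) (l.aty (\<sigma> t)) =
            walk u.T ((\<lambda>s. l.aty (\<tau> s)) ` {t<..u.r}) (l.aty (\<tau> t))"
          using walk_theta_of[OF \<sigma>, of t] walk_theta_of[OF \<tau>, of t] eq by (simp add: r_eq T_eq)
      qed (use \<sigma> \<tau> True S_perms_rel_iff r_eq in auto)
      then show ?thesis
        by (rule inj_onD[OF l.inj_aty])
          (use True permutes_in_image[OF p(1)] permutes_in_image[OF p(2)] in blast)+
    qed (use p permutes_not_in in metis)
  qed
qed

lemma KL_poly_eq:
  "KL_poly m n lam \<mu> = (\<Sum>\<sigma> \<in> S_perms_rel m n lam \<mu>. monom 1 (\<Sum>s = 1..l.r. theta_of \<sigma> s))"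
proof -
  have "bij_betw theta_of (S_perms_rel m n lam \<mu>)
      {\<theta> \<in> {1..l.r} \<rightarrow>\<^sub>E UNIV. raise_theta m n \<theta> \<mu> = lam}"
    using theta_of_inj raise_theta_of theta_of_surj
    by (intro bij_betw_imageI) (auto simp: theta_of_def)
  then have "(\<Sum>\<sigma> \<in> S_perms_rel m n lam \<mu>. monom (1::int) (\<Sum>s = 1..l.r. theta_of \<sigma> s)) =
      (\<Sum>\<theta> \<in> {\<theta> \<in> {1..l.r} \<rightarrow>\<^sub>E UNIV. raise_theta m n \<theta> \<mu> = lam}. monom 1 (\<Sum>s = 1..l.r. \<theta> s))"
    by (rule sum.reindex_bij_betw)
  then show ?thesis by (simp add: KL_poly_def r_eq)
qed

text \<open>The gain of particle \<open>s\<close> is its compressed displacement minus twice the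
  number of higher-index particles to its left, which are the inversions with first place
  \<open>s\<close>.\<close>

lemma sum_theta_of:
  assumes \<sigma>: "\<sigma> \<in> S_perms_rel m n lam \<mu>"
  shows "int (\<Sum>s = 1..l.r. theta_of \<sigma> s) = rel_length m n lam \<mu> - 2 * int (perm_length l.r \<sigma>)"
proof -
  let ?Q = "\<lambda>s. (\<lambda>t. l.aty (\<sigma> t)) ` {s<..l.r}"
  have perm: "\<sigma> permutes {1..l.r}" using \<sigma> S_perms_rel_iff by blast
  have \<sigma>_in: "\<sigma> s \<in> {1..l.r}" if "s \<in> {1..l.r}" for s using permutes_in_image[OF perm] that by blast
  have card: "card {q \<in> ?Q s. q < l.aty (\<sigma> s)} = card {t \<in> {s<..l.r}. \<sigma> t < \<sigma> s}"
    if s: "s \<in> {1..l.r}" for s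
  proof -
    have "{q \<in> ?Q s. q < l.aty (\<sigma> s)} = (\<lambda>t. l.aty (\<sigma> t)) ` {t \<in> {s<..l.r}. l.aty (\<sigma> t) < l.aty (\<sigma> s)}"
      by blast
    also have "{t \<in> {s<..l.r}. l.aty (\<sigma> t) < l.aty (\<sigma> s)} = {t \<in> {s<..l.r}. \<sigma> t < \<sigma> s}"
      by (intro Collect_cong conj_cong refl l.aty_less_iff \<sigma>_in s) auto
    also have "card ((\<lambda>t. l.aty (\<sigma> t)) ` \<dots>) = card \<dots>"
    proof (intro card_image inj_onI)
      fix t t' assume t: "t \<in> {t \<in> {s<..l.r}. \<sigma> t < \<sigma> s}" "t' \<in> {t \<in> {s<..l.r}. \<sigma> t < \<sigma> s}"
        "l.aty (\<sigma> t) = l.aty (\<sigma> t')"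
      then have "\<sigma> t = \<sigma> t'" using inj_onD[OF l.inj_aty] \<sigma>_in by auto
      then show "t = t'" using permutes_inj[OF perm] by (simp add: inj_eq)
    qed
    finally show ?thesis .
  qed
  have "int (theta_of \<sigma> s) = compress l.T (l.aty (\<sigma> s)) - compress l.T (u.aty s)
      - 2 * int (card {t \<in> {s<..l.r}. \<sigma> t < \<sigma> s})" if "s \<in> {1..l.r}" for s
    using walk_theta_of[OF \<sigma> that] card[OF that] by (simp add: walk_def)
  then have "int (\<Sum>s = 1..l.r. theta_of \<sigma> s) = (\<Sum>s = 1..l.r. compress l.T (l.aty (\<sigma> s)))
      - (\<Sum>s = 1..l.r. compress l.T (u.aty s)) - 2 * int (perm_length l.r \<sigma>)"
    by (simp add: perm_length_eq_sum sum_subtractf sum_distrib_left)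
  also have "(\<Sum>s = 1..l.r. compress l.T (l.aty (\<sigma> s))) = (\<Sum>s = 1..l.r. compress l.T (l.aty s))"
    using sum.permute[OF perm, of "\<lambda>s. compress l.T (l.aty s)"] by (simp add: comp_def)
  \<comment> \<open>Compressed coordinates are heights plus indices; the sums of indices for
    \<open>lam\<close> and \<mu> cancel.\<close>
  also have "\<dots> = total_height m n lam + (\<Sum>s = 1..l.r. int s)"
    using l.height_eq by (simp add: total_height_def sum.distrib[symmetric])
  also have "(\<Sum>s = 1..l.r. compress l.T (u.aty s)) = total_height m n \<mu> + (\<Sum>s = 1..l.r. int s)"
    using u.height_eq by (simp add: total_height_def sum.distrib[symmetric] r_eq T_eq)
  finally show ?thesis by (simp add: rel_length_def)
qed

text \<open>The set whose minimum defines \<open>b_tuple\<close> is upward closed, so lying in it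
  means being at least the minimum.\<close>

lemma b_tuple_le_iff:
  assumes "s \<in> {1..l.r}" "i \<in> {1..l.r}"
  shows "b_tuple m n lam \<mu> s \<le> int i \<longleftrightarrow> u.aty s \<le> l.aty i"
proof -
  let ?A = "{i \<in> {1..l.r}. u.aty s \<le> l.aty i}"
  have A: "finite ?A" "s \<in> ?A" using aty_le assms by auto
  have "Min ?A \<le> i \<longleftrightarrow> i \<in> ?A"
  proof
    assume le: "Min ?A \<le> i"
    have "Min ?A \<in> ?A" using A by (intro Min_in) auto
    then have "Min ?A \<in> {1..l.r}" "u.aty s \<le> l.aty (Min ?A)" by blast+
    then show "i \<in> ?A" using l.aty_le_iff[of "Min ?A" i] le assms(2) by auto
  qed (use A in \<open>auto intro: Min_le\<close>)
  then show ?thesis using assms(2) by (simp add: b_tuple_def)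
qed

lemma b_tuple_bounds:
  assumes "s \<in> {1..l.r}"
  shows "1 \<le> b_tuple m n lam \<mu> s" "b_tuple m n lam \<mu> s \<le> int s"
proof -
  let ?A = "{i \<in> {1..l.r}. u.aty s \<le> l.aty i}"
  have "Min ?A \<in> ?A" using aty_le[OF assms] assms by (intro Min_in) auto
  then show "1 \<le> b_tuple m n lam \<mu> s" by (simp add: b_tuple_def)
  show "b_tuple m n lam \<mu> s \<le> int s" using b_tuple_le_iff[OF assms assms] aty_le[OF assms] by simp
qed

text \<open>Successive atypical entries differ strictly in compressed coordinate, so subtracting the
  index keeps the heights weakly increasing; \<open>b_tuple\<close> inherits its order from the
  atypical entries of \<mu>.\<close>

lemma Z_admissible_height: "Z_admissible l.r (height m n lam) (b_tuple m n lam \<mu>)"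
proof -
  have "height m n lam s \<le> height m n lam t" if "s \<in> {1..l.r}" "t \<in> {1..l.r}" "s \<le> t" for s t
  proof -
    have "int t - int s \<le> compress l.T (l.aty t) - compress l.T (l.aty s)"
    proof (rule strict_gap[OF that(3)])
      fix k assume "s \<le> k" "k < t"
      then have "k \<in> {1..l.r}" "Suc k \<in> {1..l.r}" using that by auto
      then show "compress l.T (l.aty k) < compress l.T (l.aty (Suc k))"
        by (intro compress_strict_mono finite_typical_entries l.aty_less l.aty_notin_T) auto
    qed
    then show ?thesis using l.height_eq that(1,2) by simp
  qed
  moreover have "b_tuple m n lam \<mu> s \<le> b_tuple m n lam \<mu> t"
    if st: "s \<in> {1..l.r}" "t \<in> {1..l.r}" "s \<le> t" for s t
  proof -
    obtain i where i: "b_tuple m n lam \<mu> t = int i"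
      using b_tuple_bounds[OF st(2)] nonneg_int_cases[of "b_tuple m n lam \<mu> t"] by auto
    then have i': "i \<in> {1..l.r}" using b_tuple_bounds[OF st(2)] st(2) by auto
    then have "u.aty t \<le> l.aty i" using b_tuple_le_iff[OF st(2) i'] i by simp
    then have "u.aty s \<le> l.aty i" using u.aty_le_iff[of s t] st r_eq by simp
    then show ?thesis using b_tuple_le_iff[OF st(1) i'] i by simp
  qed
  ultimately show ?thesis using b_tuple_bounds by (auto simp: Z_admissible_def mono_on_def)
qed

lemma S_perms_rel_eq:
  "S_perms_rel m n lam \<mu> = bounded_extensions l.r (height m n lam) (b_tuple m n lam \<mu>)"
proof -
  have c: "c_hat m n lam s t = 1 \<longleftrightarrow> nested (height m n lam) s t" for s t
    by (force simp: c_hat_def c_rel_def height_dist_def nested_def)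
  have "(\<forall>s \<in> {1..l.r}. u.aty s \<le> l.aty (\<sigma> s)) \<longleftrightarrow> (\<forall>s \<in> {1..l.r}. b_tuple m n lam \<mu> s \<le> int (\<sigma> s))"
    if "\<sigma> permutes {1..l.r}" for \<sigma>
    using b_tuple_le_iff permutes_in_image[OF that] by blast
  then show ?thesis unfolding S_perms_rel_def S_perms_def bounded_extensions_def c by blast
qed

lemma S_poly_eq: "S_poly m n lam \<mu> = Z_fun l.r (height m n lam) (b_tuple m n lam \<mu>)"
  unfolding S_poly_def S_perms_rel_eq by (rule sum_bounded_extensions[OF Z_admissible_height])

lemma poly_to_fls_KL_poly:
  "poly_to_fls (KL_poly m n lam \<mu>) = fls_X_intpow (rel_length m n lam \<mu>) *
     (\<Sum>\<sigma> \<in> S_perms_rel m n lam \<mu>. fls_X_intpow (- 2 * int (perm_length l.r \<sigma>)))"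
proof -
  have "poly_to_fls (KL_poly m n lam \<mu>) =
      (\<Sum>\<sigma> \<in> S_perms_rel m n lam \<mu>. fls_X_intpow (rel_length m n lam \<mu> + - 2 * int (perm_length l.r \<sigma>)))"
    unfolding KL_poly_eq poly_to_fls_sum_monom using sum_theta_of by (intro sum.cong) simp_all
  also have "\<dots> = (\<Sum>\<sigma> \<in> S_perms_rel m n lam \<mu>. fls_X_intpow (rel_length m n lam \<mu>) *
      fls_X_intpow (- 2 * int (perm_length l.r \<sigma>)))"
    by (simp only: fls_X_intpow_times_fls_X_intpow)
  finally show ?thesis by (simp only: sum_distrib_left)
qed

end

theorem theorem3p24:
  fixes m n :: nat and lam \<mu> :: "nat \<Rightarrow> int"
  assumes "1 \<le> m" and "1 \<le> n"
    and "lam \<in> dominant_weights m n" and "\<mu> \<in> dominant_weights m n"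
  shows "(KL_poly m n lam \<mu> \<noteq> 0 \<longleftrightarrow> weight_le m n \<mu> lam) \<and>
    (weight_le m n \<mu> lam \<longrightarrow>
       poly_to_fls (KL_poly m n lam \<mu>) =
         fls_X_intpow (rel_length m n lam \<mu>) *
         (\<Sum>\<sigma> \<in> S_perms_rel m n lam \<mu>.
            fls_X_intpow (- 2 * int (perm_length (atypicality m n lam) \<sigma>))) \<and>
       poly_to_fls (KL_poly m n lam \<mu>) =
         fls_X_intpow (rel_length m n lam \<mu>) * poly_at_q_powi (S_poly m n lam \<mu>) (- 2) \<and>
       S_poly m n lam \<mu> =
         Z_fun (atypicality m n lam) (height m n lam) (b_tuple m n lam \<mu>))"
proof -
  interpret dominant_pair m n lam \<mu>
    using assms(3,4) by (simp add: dominant_pair_def dominant_weight_def)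
  have le: "weight_le m n \<mu> lam" if nz: "KL_poly m n lam \<mu> \<noteq> 0"
  proof -
    \<comment> \<open>A nonzero polynomial forces equal atypicality and a nonempty index set, hence
      some \<theta> leading from \<mu> to \<open>lam\<close>.\<close>
    have r: "l.r = u.r" using nz by (auto simp: KL_poly_def split: if_splits)
    have "{\<theta> \<in> {1..u.r} \<rightarrow>\<^sub>E UNIV. raise_theta m n \<theta> \<mu> = lam} \<noteq> {}"
      using nz r unfolding KL_poly_def by (metis sum.empty)
    then show ?thesis using weight_leI[OF r[symmetric]] by blast
  qed
  moreover have "KL_poly m n lam \<mu> \<noteq> 0 \<and>
       poly_to_fls (KL_poly m n lam \<mu>) =
         fls_X_intpow (rel_length m n lam \<mu>) *
         (\<Sum>\<sigma> \<in> S_perms_rel m n lam \<mu>.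
            fls_X_intpow (- 2 * int (perm_length (atypicality m n lam) \<sigma>))) \<and>
       poly_to_fls (KL_poly m n lam \<mu>) =
         fls_X_intpow (rel_length m n lam \<mu>) * poly_at_q_powi (S_poly m n lam \<mu>) (- 2) \<and>
       S_poly m n lam \<mu> =
         Z_fun (atypicality m n lam) (height m n lam) (b_tuple m n lam \<mu>)"
    if "weight_le m n \<mu> lam"
  proof -
    interpret comparable_pair m n lam \<mu> by unfold_locales (rule that)
    \<comment> \<open>The identity lies in \<open>S_perms_rel\<close>, so the sum of monomials is
      nonempty.\<close>
    have "KL_poly m n lam \<mu> \<noteq> 0"
      unfolding KL_poly_eq
      by (rule sum_monom_nonzero[OF finite_S_perms_rel]) (use id_in_S_perms_rel in blast)
    moreover have "poly_at_q_powi (S_poly m n lam \<mu>) (- 2) =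
        (\<Sum>\<sigma> \<in> S_perms_rel m n lam \<mu>. fls_X_intpow (- 2 * int (perm_length l.r \<sigma>)))"
      unfolding S_poly_def by (rule poly_at_q_powi_sum_monom)
    ultimately show ?thesis using poly_to_fls_KL_poly S_poly_eq by simp
  qed
  ultimately show ?thesis by blast
qed

end
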